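(* Let $\alpha\in(1,2)$. For every $f\in\mathcal{D}$, one has $$\Delta^\alpha_+\,\mathcal{V}_\alpha f \;=\; \mathcal{V}_\alpha\, D^\alpha_- f ,$$ i.e. $\Delta^\alpha_+(\mathcal{V}_\alpha f)(x)=\mathcal{V}_\alpha(D^\alpha_- f)(x)$ for every $x>0$.
   Context: Fix $\alpha\in(1,2)$; $\mathbb{R}^+=[0,\infty)$. The following operators act on functions from $\mathbb{R}^+$ to $\mathbb{R}$; for $x>0$: - $D^{\alpha-1}_+ f(x)=\dfrac{d}{dx}\displaystyle\int_0^x \frac{f(t)(x-t)^{1-\alpha}}{\Gamma(2-\alpha)}\,dt$ (left-sided Riemann-Liouville derivative of index $\alpha-1$); - $D^{\alpha}_- f(x)=\dfrac{d^2}{dx^2}\displaystyle\int_x^\infty \frac{f(t)(t-x)^{1-\alpha}}{\Gamma(2-\alpha)}\,dt$ (right-sided Riemann-Liouville derivative of index $\alpha$); - $\Delta^\alpha_+=D^{\alpha-1}_+\circ D$, where $D$ is the usual first derivative, i.e. $\Delta^\alpha_+ f=D^{\alpha-1}_+(f')$. $\mathcal{V}_\alpha$ is the multiplicative kernel $\mathcal{V}_\alpha f(x)=\mathbb{E}[f(xV_\alpha)]$, where $V_\alpha$ is a positive random variable with density on $(0,\infty)$ $$v_\alpha(t)=\frac{(-\sin\pi\alpha)\,t^{\alpha-2}(1+t)}{\pi\,(t^{2\alpha}-2t^\alpha\cos(\alpha\pi)+1)}.$$ $\mathcal{C}^2_b$ is the set of twice continuously differentiable functions $\mathbb{R}^+\to\mathbb{R}$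 such that $f'$ and $f''$ are bounded, and $$\mathcal{D}=\Big\{f\in\mathcal{C}^2_b:\ f'(0)=0 \text{ and there exists } \gamma>2-\alpha \text{ such that } \lim_{x\to+\infty}x^\gamma\big(|f(x)|+|f''(x)|\big)=0\Big\}.$$ *)

theory Defs
  imports "HOL-Probability.Probability"
begin

text \<open>Functions on the half-line \<open>[0,\<infinity>)\<close> are total functions \<open>real \<Rightarrow> real\<close> of which only the
  values on \<open>{0..}\<close> matter. Accordingly the derivative below is one-sided at \<open>0\<close>;
  at \<open>x > 0\<close> it is the usual one.\<close>

definition D1 :: "(real \<Rightarrow> real) \<Rightarrow> real \<Rightarrow> real" where
  "D1 f x = vector_derivative f (at x within {0..})"

definition RL_left_int :: "real \<Rightarrow> (real \<Rightarrow> real) \<Rightarrow> real \<Rightarrow> real" where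
  "RL_left_int \<alpha> f x = (LINT t:{0..x}|lborel. f t * (x - t) powr (1 - \<alpha>) / Gamma (2 - \<alpha>))"

text \<open>The left-sided Riemann--Liouville derivative, of index \<open>\<alpha> - 1\<close> (not \<open>\<alpha>\<close>).\<close>

definition RL_left :: "real \<Rightarrow> (real \<Rightarrow> real) \<Rightarrow> real \<Rightarrow> real" where
  "RL_left \<alpha> f x = deriv (RL_left_int \<alpha> f) x"

definition RL_right_int :: "real \<Rightarrow> (real \<Rightarrow> real) \<Rightarrow> real \<Rightarrow> real" where
  "RL_right_int \<alpha> f x = (LINT t:{x..}|lborel. f t * (t - x) powr (1 - \<alpha>) / Gamma (2 - \<alpha>))"

text \<open>The right-sided Riemann--Liouville derivative, of index \<open>\<alpha>\<close>.\<close>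

definition RL_right :: "real \<Rightarrow> (real \<Rightarrow> real) \<Rightarrow> real \<Rightarrow> real" where
  "RL_right \<alpha> f x = (deriv ^^ 2) (RL_right_int \<alpha> f) x"

definition Delta_plus :: "real \<Rightarrow> (real \<Rightarrow> real) \<Rightarrow> real \<Rightarrow> real" where
  "Delta_plus \<alpha> f = RL_left \<alpha> (D1 f)"

definition v_density :: "real \<Rightarrow> real \<Rightarrow> real" where
  "v_density \<alpha> t = (if t > 0 then
     (- sin (pi * \<alpha>)) * t powr (\<alpha> - 2) * (1 + t) /
     (pi * (t powr (2 * \<alpha>) - 2 * t powr \<alpha> * cos (\<alpha> * pi) + 1)) else 0)"

definition mult_kernel :: "'a measure \<Rightarrow> ('a \<Rightarrow> real) \<Rightarrow> (real \<Rightarrow> real) \<Rightarrow> real \<Rightarrow> real" where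
  "mult_kernel M V f x = integral\<^sup>L M (\<lambda>\<omega>. f (x * V \<omega>))"

text \<open>In HOL, \<open>deriv\<close> and the integral return arbitrary values where the derivative or integral
  does not exist. The following predicates say that it does exist, on \<open>(0,\<infinity>)\<close>.\<close>

definition RL_left_defined :: "real \<Rightarrow> (real \<Rightarrow> real) \<Rightarrow> bool" where
  "RL_left_defined \<alpha> f \<longleftrightarrow> (\<forall>x>0.
     set_integrable lborel {0..x} (\<lambda>t. f t * (x - t) powr (1 - \<alpha>) / Gamma (2 - \<alpha>)) \<and>
     RL_left_int \<alpha> f field_differentiable at x)"

definition RL_right_defined :: "real \<Rightarrow> (real \<Rightarrow> real) \<Rightarrow> bool" where
  "RL_right_defined \<alpha> f \<longleftrightarrow> (\<forall>x>0.
     set_integrable lborel {x..} (\<lambda>t. f t * (t - x) powr (1 - \<alpha>) / Gamma (2 - \<alpha>)) \<and>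
     RL_right_int \<alpha> f field_differentiable at x \<and>
     deriv (RL_right_int \<alpha> f) field_differentiable at x)"

definition Delta_plus_defined :: "real \<Rightarrow> (real \<Rightarrow> real) \<Rightarrow> bool" where
  "Delta_plus_defined \<alpha> f \<longleftrightarrow>
     (\<forall>x>0. f field_differentiable at x) \<and> RL_left_defined \<alpha> (D1 f)"

definition mult_kernel_defined :: "'a measure \<Rightarrow> ('a \<Rightarrow> real) \<Rightarrow> (real \<Rightarrow> real) \<Rightarrow> bool" where
  "mult_kernel_defined M V f \<longleftrightarrow> (\<forall>x>0. integrable M (\<lambda>\<omega>. f (x * V \<omega>)))"

text \<open>As in the definition of the space, \<open>f\<close> itself is not required to be bounded.\<close>

definition C2b :: "(real \<Rightarrow> real) set" where
  "C2b = {f. f differentiable_on {0..} \<and> D1 f differentiable_on {0..} \<and>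
     continuous_on {0..} (D1 (D1 f)) \<and>
     bounded (D1 f ` {0..}) \<and> bounded (D1 (D1 f) ` {0..})}"

definition test_space :: "real \<Rightarrow> (real \<Rightarrow> real) set" where
  "test_space \<alpha> = {f \<in> C2b. D1 f 0 = 0 \<and>
     (\<exists>\<gamma>>2 - \<alpha>. ((\<lambda>x. x powr \<gamma> * (\<bar>f x\<bar> + \<bar>D1 (D1 f) x\<bar>)) \<longlongrightarrow> 0) at_top)}"

end

theory Submission
  imports Defs "HOL-Complex_Analysis.Complex_Analysis" "HOL-Real_Asymp.Real_Asymp"
begin

text \<open>
  Let \<open>v\<close> be the density of \<open>V\<^sub>\<alpha>\<close>, and let \<open>f\<close> be
  a test function. Up to the factor \<open>1 / \<Gamma>(2 - \<alpha>)\<close>, differentiation under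
  the integral sign gives
  \<open>D^\<alpha>_- f(x) = \<integral> f''(u) (u - x)^(1 - \<alpha>) du\<close> over
  \<open>u > x\<close>, so the right-hand side at \<open>x = r\<close> is the average
  \<open>H(r)\<close> over \<open>y\<close> of the integral of
  \<open>f''(u) (u - r y)^(1 - \<alpha>)\<close> over \<open>u > r y\<close>. The left-hand side
  involves left-sided integrals, that is, integrals over \<open>u < r y\<close>. The two are linked by
  one identity for the density: for every \<open>c > 0\<close> the integral of
  \<open>v(y) (c - y)^(1 - \<alpha>)\<close> over \<open>0 < y < c\<close> equals the integral of
  \<open>y^\<alpha> v(y) (y - c)^(1 - \<alpha>)\<close> over \<open>y > c\<close>. This is the only
  place where the particular form of the density matters beyond its moments.

  The identity (lemma \<open>density_balance\<close>) is Cauchy's theorem for the function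
  \<open>\<Phi>(z) = z^(\<alpha> - 2) (c + z)^(1 - \<alpha>) (z - 1) / (z^\<alpha> - 1)\<close>, which
  is holomorphic on the plane slit along the negative axis: \<open>z = 1\<close> is the only zero of
  the denominator because \<open>\<alpha> < 2\<close>. It is real on the positive axis, and
  \<open>z \<Phi>(z)\<close> tends to \<open>0\<close> at \<open>0\<close> and at infinity, so the
  imaginary part of its integral along the upper side of the negative axis vanishes. That imaginary
  part is, up to the factor \<open>\<pi>\<close>, the difference of the two sides of the identity
  (lemma \<open>Im_Phi_boundary\<close>).

  By scaling and Fubini's theorem, the identity turns \<open>H(r)\<close> into the integral of
  \<open>v(y) y^\<alpha> Q(r y)\<close>, where \<open>Q\<close> is the left-sided fractional integral
  of \<open>f''\<close> (lemma \<open>H_eq\<close>). Integrate this over \<open>0 < r < x\<close>: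
  since \<open>f'(0) = 0\<close>, the primitive of \<open>Q\<close> is the fractional integral of
  \<open>f'\<close> (lemma \<open>W_eq\<close>), and by homogeneity the result is the fractional
  integral of \<open>G(t) = E[V f'(t V)]\<close>, the derivative of the multiplicative kernel of
  \<open>f\<close> (lemma \<open>fractional_integral_identity\<close>). So the function whose
  derivative defines the left-hand side is a primitive of the right-hand side, and \<open>H\<close> is
  continuous. Working with primitives avoids the second derivative of the multiplicative kernel, which
  may be singular at \<open>0\<close>.

  The decay of \<open>f\<close> and \<open>f''\<close> passes to \<open>f'\<close> by the mean value
  theorem (lemma \<open>landau_derivative_bound\<close>) and provides all integrable bounds.
\<close>

section \<open>Integrals depending on a parameter and integrals of powers\<close>

lemma lborel_powr_near_0:
  fixes a c :: real
  assumes "a > -1" "c \<ge> 0"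
  shows "integrable lborel (\<lambda>x. indicator {0<..c} x * x powr a)"
proof (rule integrableI_nonneg)
  have "((\<lambda>x. x powr a) has_integral (c powr (a+1) / (a+1))) {0..c}"
    using assms by (rule has_integral_powr_from_0)
  hence "((\<lambda>x. if x \<in> {0..c} then x powr a else 0) has_integral (c powr (a+1) / (a+1))) UNIV"
    by (simp only: has_integral_restrict_UNIV)
  moreover have "(\<lambda>x. if x \<in> {0..c} then x powr a else 0) = (\<lambda>x. indicator {0<..c} x * x powr a)"
    by (auto simp: fun_eq_iff indicator_def)
  ultimately have "(\<integral>\<^sup>+ x. indicator {0<..c} x * x powr a \<partial>lborel) = (c powr (a+1) / (a+1))"
    by (intro nn_integral_has_integral_lborel) auto
  thus "(\<integral>\<^sup>+ x. indicator {0<..c} x * x powr a \<partial>lborel) < \<infinity>" by simp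
qed auto

lemma lborel_powr_at_infinity:
  fixes a c :: real
  assumes "a < -1" "c > 0"
  shows "integrable lborel (\<lambda>x. indicator {c..} x * x powr a)"
proof (rule integrableI_nonneg)
  have "((\<lambda>x. x powr a) has_integral (-(c powr (a+1)) / (a+1))) {c..}"
    using assms by (rule has_integral_powr_to_inf)
  hence "((\<lambda>x. if x \<in> {c..} then x powr a else 0) has_integral (-(c powr (a+1)) / (a+1))) UNIV"
    by (simp only: has_integral_restrict_UNIV)
  moreover have "(\<lambda>x. if x \<in> {c..} then x powr a else 0) = (\<lambda>x. indicator {c..} x * x powr a)"
    by (auto simp: fun_eq_iff indicator_def)
  ultimately have "(\<integral>\<^sup>+ x. indicator {c..} x * x powr a \<partial>lborel) = (-(c powr (a+1)) / (a+1))"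
    by (intro nn_integral_has_integral_lborel) auto
  thus "(\<integral>\<^sup>+ x. indicator {c..} x * x powr a \<partial>lborel) < \<infinity>" by simp
qed auto

text \<open>Both sides of a power singularity at \<open>c\<close>, obtained by reflecting and translating the
one-sided case.\<close>

lemma lborel_powr_dist:
  fixes a c d :: real
  assumes "a > -1" "d \<ge> 0"
  shows "integrable lborel (\<lambda>x. indicator {c-d..c+d} x * \<bar>c - x\<bar> powr a)"
proof -
  have 1: "integrable lborel (\<lambda>x. indicator {0<..d} (- c + 1 * x) * (- c + 1 * x) powr a)"
    by (rule lborel_integrable_real_affine[OF lborel_powr_near_0[OF assms]]) simp
  have 2: "integrable lborel (\<lambda>x. indicator {0<..d} (c + (-1) * x) * (c + (-1) * x) powr a)"
    by (rule lborel_integrable_real_affine[OF lborel_powr_near_0[OF assms]]) simp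
  have "integrable lborel (\<lambda>x. indicator {0<..d} (c + (-1) * x) * (c + (-1) * x) powr a
       + indicator {0<..d} (- c + 1 * x) * (- c + 1 * x) powr a)"
    using 1 2 by (rule Bochner_Integration.integrable_add[rotated])
  also have "(\<lambda>x. indicator {0<..d} (c + (-1) * x) * (c + (-1) * x) powr a
       + indicator {0<..d} (- c + 1 * x) * (- c + 1 * x) powr a)
      = (\<lambda>x. indicator {c-d..c+d} x * \<bar>c - x\<bar> powr a)"
    by (auto simp: fun_eq_iff indicator_def abs_if)
  finally show ?thesis .
qed

lemma integrable_lborel_prod:
  fixes f g :: "real \<Rightarrow> real"
  assumes f: "integrable lborel f" and g: "integrable lborel g"
  shows "integrable (lborel \<Otimes>\<^sub>M lborel) (\<lambda>(x, y). f x * g y)"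
proof (rule lborel_pair.Fubini_integrable)
  have [measurable]: "f \<in> borel_measurable borel" "g \<in> borel_measurable borel" using f g by auto
  show "(\<lambda>(x, y). f x * g y) \<in> borel_measurable (lborel \<Otimes>\<^sub>M lborel)" by measurable
  have "integrable lborel (\<lambda>x. norm (f x) * (LINT y|lborel. norm (g y)))"
    using f by (intro integrable_mult_left integrable_norm)
  thus "integrable lborel (\<lambda>x. LINT y|lborel. norm (case (x, y) of (x, y) \<Rightarrow> f x * g y))"
    by (simp add: abs_mult)
  show "AE x in lborel. integrable lborel (\<lambda>y. case (x, y) of (x, y) \<Rightarrow> f x * g y)"
    using g by simp
qed

text \<open>Two nonnegative kernels with the same mass over \<open>y\<close> for every \<open>u\<close> act
identically after integration in \<open>y\<close>: by Tonelli only the mass over \<open>y\<close>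
matters. Absolute convergence has to be checked for one of the two kernels only.\<close>

lemma kernel_swap:
  fixes K1 K2 :: "real \<Rightarrow> real \<Rightarrow> real" and \<phi> :: "real \<Rightarrow> real"
  assumes [measurable]: "case_prod K1 \<in> borel_measurable (lborel \<Otimes>\<^sub>M lborel)"
      "case_prod K2 \<in> borel_measurable (lborel \<Otimes>\<^sub>M lborel)" "\<phi> \<in> borel_measurable lborel"
    and nn: "\<And>y u. 0 \<le> K1 y u" "\<And>y u. 0 \<le> K2 y u"
    and eq: "\<And>u. (\<integral>\<^sup>+y. ennreal (K1 y u) \<partial>lborel) = (\<integral>\<^sup>+y. ennreal (K2 y u) \<partial>lborel)"
  shows kernel_swap_nn: "(\<integral>\<^sup>+y. \<integral>\<^sup>+u. ennreal (K1 y u * \<bar>\<phi> u\<bar>) \<partial>lborel \<partial>lborel)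
          = (\<integral>\<^sup>+y. \<integral>\<^sup>+u. ennreal (K2 y u * \<bar>\<phi> u\<bar>) \<partial>lborel \<partial>lborel)" (is "?A = ?B")
    and kernel_swap_integral: "(\<integral>\<^sup>+y. \<integral>\<^sup>+u. ennreal (K1 y u * \<bar>\<phi> u\<bar>) \<partial>lborel \<partial>lborel) < \<infinity> \<Longrightarrow>
          (\<integral>y. \<integral>u. K1 y u * \<phi> u \<partial>lborel \<partial>lborel) = (\<integral>y. \<integral>u. K2 y u * \<phi> u \<partial>lborel \<partial>lborel)"
proof -
  have fub: "(\<integral>\<^sup>+y. \<integral>\<^sup>+u. ennreal (K y u * \<bar>\<phi> u\<bar>) \<partial>lborel \<partial>lborel)
      = (\<integral>\<^sup>+u. (\<integral>\<^sup>+y. ennreal (K y u) \<partial>lborel) * ennreal \<bar>\<phi> u\<bar> \<partial>lborel)"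
    if [measurable]: "case_prod K \<in> borel_measurable (lborel \<Otimes>\<^sub>M lborel)" and K: "\<And>y u. 0 \<le> K y u" for K
  proof -
    have "(\<integral>\<^sup>+y. \<integral>\<^sup>+u. ennreal (K y u * \<bar>\<phi> u\<bar>) \<partial>lborel \<partial>lborel)
        = (\<integral>\<^sup>+u. \<integral>\<^sup>+y. ennreal (K y u * \<bar>\<phi> u\<bar>) \<partial>lborel \<partial>lborel)"
      by (rule lborel_pair.Fubini') measurable
    also have "\<dots> = (\<integral>\<^sup>+u. (\<integral>\<^sup>+y. ennreal (K y u) \<partial>lborel) * ennreal \<bar>\<phi> u\<bar> \<partial>lborel)"
      by (intro nn_integral_cong) (simp add: ennreal_mult'[OF K] nn_integral_multc)
    finally show ?thesis .
  qed
  show *: "?A = ?B"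
    using fub[of K1] fub[of K2] nn by (simp add: eq)
  assume fin: "?A < \<infinity>"
  have int: "integrable (lborel \<Otimes>\<^sub>M lborel) (\<lambda>(y, u). K y u * \<phi> u)"
    if [measurable]: "case_prod K \<in> borel_measurable (lborel \<Otimes>\<^sub>M lborel)" and K: "\<And>y u. 0 \<le> K y u" 
      and fin: "(\<integral>\<^sup>+y. \<integral>\<^sup>+u. ennreal (K y u * \<bar>\<phi> u\<bar>) \<partial>lborel \<partial>lborel) < \<infinity>" for K
  proof (rule integrableI_bounded)
    have "(\<integral>\<^sup>+ x. ennreal (norm (case x of (y, u) \<Rightarrow> K y u * \<phi> u)) \<partial>(lborel \<Otimes>\<^sub>M lborel))
        = (\<integral>\<^sup>+y. \<integral>\<^sup>+u. ennreal (K y u * \<bar>\<phi> u\<bar>) \<partial>lborel \<partial>lborel)"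
      by (subst lborel.nn_integral_fst[symmetric]) (auto simp: abs_mult K)
    thus "(\<integral>\<^sup>+ x. ennreal (norm (case x of (y, u) \<Rightarrow> K y u * \<phi> u)) \<partial>(lborel \<Otimes>\<^sub>M lborel)) < \<infinity>"
      using fin by simp
  qed measurable
  have swap: "(\<integral>y. \<integral>u. K y u * \<phi> u \<partial>lborel \<partial>lborel) = (\<integral>u. enn2real (\<integral>\<^sup>+y. ennreal (K y u) \<partial>lborel) * \<phi> u \<partial>lborel)"
    if [measurable]: "case_prod K \<in> borel_measurable (lborel \<Otimes>\<^sub>M lborel)" and K: "\<And>y u. 0 \<le> K y u" 
      and fin: "(\<integral>\<^sup>+y. \<integral>\<^sup>+u. ennreal (K y u * \<bar>\<phi> u\<bar>) \<partial>lborel \<partial>lborel) < \<infinity>" for K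
  proof -
    have "(\<integral>y. \<integral>u. K y u * \<phi> u \<partial>lborel \<partial>lborel) = (\<integral>u. \<integral>y. K y u * \<phi> u \<partial>lborel \<partial>lborel)"
      by (rule lborel_pair.Fubini_integral[symmetric]) (rule int[OF that])
    also have "\<dots> = (\<integral>u. enn2real (\<integral>\<^sup>+y. ennreal (K y u) \<partial>lborel) * \<phi> u \<partial>lborel)"
      by (intro Bochner_Integration.integral_cong) (simp_all add: integral_eq_nn_integral K)
    finally show ?thesis .
  qed
  show "(\<integral>y. \<integral>u. K1 y u * \<phi> u \<partial>lborel \<partial>lborel) = (\<integral>y. \<integral>u. K2 y u * \<phi> u \<partial>lborel \<partial>lborel)"
    using swap[OF assms(1) nn(1) fin] swap[OF assms(2) nn(2)] fin * eq by simp
qed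

text \<open>Dominated convergence for a real parameter, reduced to sequences; it yields both continuity and
differentiability under the integral sign.\<close>

lemma dominated_convergence_at:
  fixes s :: "real \<Rightarrow> 'a \<Rightarrow> real" and x :: real
  assumes meas: "\<And>t. s t \<in> borel_measurable M" "f \<in> borel_measurable M"
    and lim: "\<And>w. w \<in> space M \<Longrightarrow> ((\<lambda>t. s t w) \<longlongrightarrow> f w) (at x)"
    and bound: "\<forall>\<^sub>F t in at x. \<forall>w\<in>space M. \<bar>s t w\<bar> \<le> B w" and B: "integrable M B"
  shows "((\<lambda>t. \<integral>w. s t w \<partial>M) \<longlongrightarrow> (\<integral>w. f w \<partial>M)) (at x)"
  unfolding tendsto_at_iff_sequentially comp_def
proof (intro allI impI)
  fix X :: "nat \<Rightarrow> real" assume X: "\<forall>i. X i \<in> UNIV - {x}" "X \<longlonglongrightarrow> x"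
  have fl: "filterlim X (at x) sequentially" using X by (auto simp: filterlim_at)
  from eventually_compose_filterlim[OF bound fl]
  obtain n where n: "\<And>i w. i \<ge> n \<Longrightarrow> w \<in> space M \<Longrightarrow> \<bar>s (X i) w\<bar> \<le> B w"
    unfolding eventually_sequentially by blast
  show "(\<lambda>i. \<integral>w. s (X i) w \<partial>M) \<longlonglongrightarrow> (\<integral>w. f w \<partial>M)"
  proof (rule LIMSEQ_offset[of _ n], rule integral_dominated_convergence[OF meas(2) meas(1) B])
    show "AE w in M. (\<lambda>i. s (X (i + n)) w) \<longlonglongrightarrow> f w"
    proof (rule AE_I2)
      fix w assume "w \<in> space M"
      from filterlim_compose[OF lim[OF this] fl]
      show "(\<lambda>i. s (X (i + n)) w) \<longlonglongrightarrow> f w" by (rule LIMSEQ_ignore_initial_segment)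
    qed
    show "AE w in M. norm (s (X (i + n)) w) \<le> B w" for i
      using n[of "i + n"] by (intro AE_I2) simp
  qed
qed

lemma has_derivative_under_integral:
  fixes h h' :: "real \<Rightarrow> 'a \<Rightarrow> real" and x d :: real
  assumes d: "d > 0"
    and meas: "\<And>t. h t \<in> borel_measurable M" "h' x \<in> borel_measurable M"
    and int: "\<And>t. \<bar>t - x\<bar> < d \<Longrightarrow> integrable M (h t)"
    and deriv: "\<And>t w. \<bar>t - x\<bar> < d \<Longrightarrow> w \<in> space M \<Longrightarrow> ((\<lambda>t. h t w) has_real_derivative h' t w) (at t)"
    and bound: "\<And>t w. \<bar>t - x\<bar> < d \<Longrightarrow> w \<in> space M \<Longrightarrow> \<bar>h' t w\<bar> \<le> B w" and B: "integrable M B"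
  shows "((\<lambda>t. \<integral>w. h t w \<partial>M) has_real_derivative (\<integral>w. h' x w \<partial>M)) (at x)"
proof -
  have near: "\<forall>\<^sub>F t in at x. \<bar>t - x\<bar> < d \<and> t \<noteq> x"
    using d by (auto simp: eventually_at dist_real_def intro!: exI[of _ d])
  have "((\<lambda>t. \<integral>w. (h t w - h x w) / (t - x) \<partial>M) \<longlongrightarrow> (\<integral>w. h' x w \<partial>M)) (at x)"
  proof (rule dominated_convergence_at[OF _ meas(2) _ _ B])
    show "(\<lambda>w. (h t w - h x w) / (t - x)) \<in> borel_measurable M" for t
      using meas(1)[of t] meas(1)[of x] by measurable
    show "((\<lambda>t. (h t w - h x w) / (t - x)) \<longlongrightarrow> h' x w) (at x)" if "w \<in> space M" for w
      using deriv[of x w] that d by (simp add: has_field_derivative_iff)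
    show "\<forall>\<^sub>F t in at x. \<forall>w\<in>space M. \<bar>(h t w - h x w) / (t - x)\<bar> \<le> B w"
      using near
    proof (eventually_elim, intro ballI)
      fix t w assume t: "\<bar>t - x\<bar> < d \<and> t \<noteq> x" and w: "w \<in> space M"
      have "norm (h t w - h x w) \<le> B w * norm (t - x)"
      proof (rule field_differentiable_bound[where S = "ball x d" and f' = "\<lambda>t. h' t w"])
        fix u assume "u \<in> ball x d"
        hence u: "\<bar>u - x\<bar> < d" by (simp add: dist_real_def abs_minus_commute)
        show "((\<lambda>t. h t w) has_field_derivative h' u w) (at u within ball x d)"
          by (rule has_field_derivative_at_within[OF deriv[OF u w]])
        show "norm (h' u w) \<le> B w" using bound[OF u w] by simp
      qed (use t d in \<open>auto simp: dist_real_def abs_minus_commute\<close>)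
      thus "\<bar>(h t w - h x w) / (t - x)\<bar> \<le> B w"
        using t by (simp add: abs_divide divide_le_eq)
    qed
  qed
  moreover have "\<forall>\<^sub>F t in at x. (\<integral>w. (h t w - h x w) / (t - x) \<partial>M) = ((\<integral>w. h t w \<partial>M) - (\<integral>w. h x w \<partial>M)) / (t - x)"
    using near
  proof eventually_elim
    case (elim t)
    hence "integrable M (h t)" "integrable M (h x)" using int[of t] int[of x] d by auto
    thus ?case by simp
  qed
  ultimately have "((\<lambda>t. ((\<integral>w. h t w \<partial>M) - (\<integral>w. h x w \<partial>M)) / (t - x)) \<longlongrightarrow> (\<integral>w. h' x w \<partial>M)) (at x)"
    by (rule Lim_transform_eventually)
  thus ?thesis by (simp add: has_field_derivative_iff)
qed

section \<open>Complex powers on the slit plane\<close>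

lemma powr_rcis:
  assumes "r > 0" "- pi < x" "x \<le> pi"
  shows "rcis r x powr complex_of_real a = rcis (r powr a) (a * x)"
proof -
  have "Ln (rcis r x) = Complex (ln r) x"
    using assms by (intro Ln_rcis) auto
  moreover have "rcis r x \<noteq> 0" using assms by simp
  ultimately have "rcis r x powr complex_of_real a = exp (of_real a * Complex (ln r) x)"
    by (simp add: powr_def)
  also have "\<dots> = rcis (r powr a) (a * x)"
    using assms by (simp add: exp_eq_polar rcis_def powr_def)
  finally show ?thesis .
qed

lemma rcis_slit: "r > 0 \<Longrightarrow> - pi < x \<Longrightarrow> x < pi \<Longrightarrow> rcis r x \<notin> \<real>\<^sub>\<le>\<^sub>0"
proof
  assume *: "r > 0" "- pi < x" "x < pi" "rcis r x \<in> \<real>\<^sub>\<le>\<^sub>0"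
  hence "sin x = 0" "cos x \<le> 0" by (auto simp: complex_nonpos_Reals_iff mult_le_0_iff)
  moreover have "x = 0" using sin_eq_0_pi * calculation by auto
  ultimately show False by simp
qed

lemma shift_slit: "c > 0 \<Longrightarrow> z \<notin> \<real>\<^sub>\<le>\<^sub>0 \<Longrightarrow> complex_of_real c + z \<notin> \<real>\<^sub>\<le>\<^sub>0"
  by (auto simp: complex_nonpos_Reals_iff)

lemma norm_rcis_minus_1: "(norm (rcis s x - 1))\<^sup>2 = s\<^sup>2 - 2 * s * cos x + 1"
proof -
  have "(norm (rcis s x - 1))\<^sup>2 = (s * cos x - 1)\<^sup>2 + (s * sin x)\<^sup>2"
    by (simp add: cmod_power2)
  also have "\<dots> = s\<^sup>2 * ((sin x)\<^sup>2 + (cos x)\<^sup>2) - 2 * s * cos x + 1"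
    by algebra
  finally show ?thesis unfolding sin_cos_squared_add by simp
qed

text \<open>A lower bound that is uniform in the modulus \<open>s\<close> as long as the angle stays away from
the multiples of \<open>2\<pi>\<close>.\<close>

lemma norm_rcis_minus_1_ge:
  assumes "cos x \<le> k" "0 \<le> k" "k \<le> 1" "s \<ge> 0"
  shows "norm (rcis s x - 1) \<ge> (1 - k) * max 1 s"
proof (rule power2_le_imp_le)
  have "(norm (rcis s x - 1))\<^sup>2 = s\<^sup>2 - 2 * s * cos x + 1"
    by (rule norm_rcis_minus_1)
  moreover have "s * cos x \<le> s * k" using assms by (intro mult_left_mono)
  moreover have "2 * s * k \<le> (1 + s\<^sup>2) * k"
    using assms sum_squares_bound[of 1 s] by (intro mult_right_mono) auto
  ultimately have 1: "(norm (rcis s x - 1))\<^sup>2 \<ge> (1 - k) * (1 + s\<^sup>2)"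
    by (simp add: algebra_simps)
  have "((1 - k) * max 1 s)\<^sup>2 = (1 - k)\<^sup>2 * (max 1 s)\<^sup>2" by (simp add: power_mult_distrib)
  also have "\<dots> \<le> (1 - k) * (1 + s\<^sup>2)"
    using assms by (intro mult_mono) (auto simp: power2_eq_square max_def mult_left_le_one_le)
  finally show "((1 - k) * max 1 s)\<^sup>2 \<le> (norm (rcis s x - 1))\<^sup>2" using 1 by linarith
qed simp

text \<open>The principal branch takes on the negative axis its limit from the upper half plane, so a sequence
approaching the axis from above sees no jump.\<close>

lemma tendsto_powr_upper:
  fixes w :: "nat \<Rightarrow> complex" and x b :: real
  assumes w: "w \<longlonglongrightarrow> of_real x" and im: "\<And>n. Im (w n) > 0" and x: "x \<noteq> 0"
  shows "(\<lambda>n. w n powr of_real b) \<longlonglongrightarrow> of_real x powr of_real b"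
proof (cases "x > 0")
  case True
  thus ?thesis using w by (intro tendsto_powr_complex) (auto simp: complex_nonpos_Reals_iff)
next
  case False
  hence x: "x < 0" using x by simp
  have ln_eq: "Ln u = Ln (- u) + \<i> * pi" if "Im u > 0 \<or> (Im u = 0 \<and> Re u < 0)" for u
  proof -
    have "-u \<noteq> 0" "Im (- u) \<le> 0" "\<not> (Re (- u) < 0 \<and> Im (- u) = 0)" using that by auto
    from Ln_minus[OF this(1)] this show ?thesis by (metis minus_minus)
  qed
  have "(\<lambda>n. Ln (- w n)) \<longlonglongrightarrow> Ln (- of_real x)"
    using x by (intro tendsto_Ln tendsto_minus assms) (auto simp: complex_nonpos_Reals_iff)
  hence "(\<lambda>n. exp (of_real b * (Ln (- w n) + \<i> * pi))) \<longlonglongrightarrow> exp (of_real b * (Ln (- of_real x) + \<i> * pi))"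
    by (intro tendsto_exp tendsto_mult tendsto_add tendsto_const)
  moreover have "w n powr of_real b = exp (of_real b * (Ln (- w n) + \<i> * pi))" for n
    using im[of n] ln_eq[of "w n"] by (auto simp: powr_def)
  moreover have "of_real x powr of_real b = exp (of_real b * (Ln (- of_real x) + \<i> * pi))"
    using x ln_eq[of "of_real x"] by (auto simp: powr_def)
  ultimately show ?thesis by simp
qed

section \<open>A holomorphic function with the density as boundary value\<close>

locale stable_index =
  fixes \<alpha> :: real
  assumes alpha_gt_1: "1 < \<alpha>" and alpha_lt_2: "\<alpha> < 2"
begin

text \<open>The analytic extension of \<open>(z^\<alpha> - 1) / (z - 1)\<close> over its removable singularity
at \<open>1\<close>.\<close>

definition power_quotient :: "complex \<Rightarrow> complex" where
  "power_quotient z = (if z = 1 then of_real \<alpha> else (z powr of_real \<alpha> - 1) / (z - 1))"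

lemma holomorphic_power_quotient: "power_quotient holomorphic_on (- \<real>\<^sub>\<le>\<^sub>0)"
proof -
  let ?f = "\<lambda>z. z powr complex_of_real \<alpha>"
  have hol: "?f holomorphic_on (- \<real>\<^sub>\<le>\<^sub>0)"
    by (intro holomorphic_intros) auto
  have d: "deriv ?f 1 = of_real \<alpha>"
  proof -
    have "(?f has_field_derivative (of_real \<alpha> * 1 powr (of_real \<alpha> - 1))) (at 1)"
      by (rule has_field_derivative_powr) (auto simp: complex_nonpos_Reals_iff)
    thus ?thesis by (simp add: DERIV_imp_deriv)
  qed
  have "(\<lambda>z. if z = 1 then deriv ?f 1 else (?f z - ?f 1) / (z - 1)) holomorphic_on (- \<real>\<^sub>\<le>\<^sub>0)"
    by (rule pole_lemma_open[OF hol]) (simp add: closed_nonpos_Reals_complex open_Compl)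
  moreover have one: "?f 1 = 1" by (simp add: powr_def)
  ultimately show ?thesis unfolding d one power_quotient_def [abs_def] by simp
qed

text \<open>Since \<open>\<alpha> < 2\<close>, the angle of \<open>z^\<alpha>\<close> stays strictly between
\<open>-2\<pi>\<close> and \<open>2\<pi>\<close> on the slit plane, so \<open>z^\<alpha> = 1\<close>
happens at \<open>z = 1\<close> only, and there the quotient is \<open>\<alpha>\<close>.\<close>

lemma power_quotient_nonzero:
  assumes "z \<notin> \<real>\<^sub>\<le>\<^sub>0"
  shows "power_quotient z \<noteq> 0"
proof (cases "z = 1")
  case True
  then show ?thesis using alpha_gt_1 by (simp add: power_quotient_def)
next
  case False
  have nz: "z \<noteq> 0" using assms by auto
  have "z powr of_real \<alpha> \<noteq> 1"
  proof
    assume "z powr of_real \<alpha> = 1"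
    hence "exp (of_real \<alpha> * Ln z) = 1" using nz by (simp add: powr_def)
    then obtain n :: int where n: "Re (of_real \<alpha> * Ln z) = 0"
        "Im (of_real \<alpha> * Ln z) = of_int (2 * n) * pi"
      by (auto simp: exp_eq_1)
    have "\<bar>Im (Ln z)\<bar> < pi"
      using Im_Ln_less_pi[OF assms] mpi_less_Im_Ln[OF nz] by linarith
    hence "\<alpha> * \<bar>Im (Ln z)\<bar> < 2 * pi"
      using alpha_gt_1 alpha_lt_2 by (intro mult_strict_mono) auto
    hence "\<bar>of_int (2 * n) * pi\<bar> < 2 * pi"
      using n alpha_gt_1 abs_mult[of \<alpha> "Im (Ln z)"] by simp
    hence "\<bar>real_of_int n\<bar> * (2 * pi) < 1 * (2 * pi)" by (simp add: abs_mult algebra_simps)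
    hence "\<bar>real_of_int n\<bar> < 1" by (rule mult_right_less_imp_less) simp
    hence "n = 0" by linarith
    hence "Ln z = 0" using n alpha_gt_1 by (simp add: complex_eq_iff)
    hence "z = 1" using nz by (metis exp_Ln exp_zero)
    thus False using False by simp
  qed
  thus ?thesis using False by (simp add: power_quotient_def)
qed

text \<open>The limits on the upper side of the negative axis contain the density of
\<open>V\<^sub>\<alpha>\<close>, while the values on the positive axis are real. The factor
\<open>(z - 1) / (z^\<alpha> - 1)\<close> accounts for the factor \<open>1 + y\<close> and the
denominator of the density.\<close>

definition Phi :: "real \<Rightarrow> complex \<Rightarrow> complex" where
  "Phi c z = z powr of_real (\<alpha> - 2) * (of_real c + z) powr of_real (1 - \<alpha>) / power_quotient z"

lemma holomorphic_Phi: "c > 0 \<Longrightarrow> Phi c holomorphic_on (- \<real>\<^sub>\<le>\<^sub>0)"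
  unfolding Phi_def [abs_def]
  by (intro holomorphic_intros holomorphic_power_quotient)
     (auto simp: power_quotient_nonzero shift_slit)

text \<open>The slit plane is star-shaped about \<open>1\<close>. A primitive replaces all contour integrals
below.\<close>

lemma Phi_primitive:
  assumes "c > 0"
  obtains P where "\<And>z. z \<notin> \<real>\<^sub>\<le>\<^sub>0 \<Longrightarrow> (P has_field_derivative Phi c z) (at z)"
proof -
  have op: "open (- \<real>\<^sub>\<le>\<^sub>0 :: complex set)"
    by (simp add: closed_nonpos_Reals_complex open_Compl)
  have st: "starlike (- \<real>\<^sub>\<le>\<^sub>0 :: complex set)"
    unfolding starlike_def
  proof (intro bexI ballI)
    show "(1::complex) \<in> - \<real>\<^sub>\<le>\<^sub>0" by (simp add: complex_nonpos_Reals_iff)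
    fix z :: complex assume z: "z \<in> - \<real>\<^sub>\<le>\<^sub>0"
    show "closed_segment 1 z \<subseteq> - \<real>\<^sub>\<le>\<^sub>0"
    proof
      fix w assume "w \<in> closed_segment 1 z"
      then obtain u where u: "0 \<le> u" "u \<le> 1" "w = (1 - u) *\<^sub>R 1 + u *\<^sub>R z"
        by (auto simp: closed_segment_def)
      show "w \<in> - \<real>\<^sub>\<le>\<^sub>0"
      proof (rule ccontr)
        assume "w \<notin> - \<real>\<^sub>\<le>\<^sub>0"
        hence w: "Re w \<le> 0" "Im w = 0" by (auto simp: complex_nonpos_Reals_iff)
        hence uz: "u * Im z = 0" "1 - u + u * Re z \<le> 0" using u by auto
        hence "u \<noteq> 0" by auto
        hence "Im z = 0" using uz by simp
        hence "Re z > 0" using z by (auto simp: complex_nonpos_Reals_iff)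
        hence "u * Re z > 0" using u \<open>u \<noteq> 0\<close> by simp
        thus False using uz u by linarith
      qed
    qed
  qed
  have "\<exists>g. \<forall>x \<in> - \<real>\<^sub>\<le>\<^sub>0. (g has_field_derivative Phi c x) (at x)"
    using holomorphic_Phi[OF assms] op
    by (intro holomorphic_starlike_primitive[OF _ st op, of _ "{}"])
       (auto intro: holomorphic_on_imp_continuous_on simp: holomorphic_on_open field_differentiable_def)
  thus ?thesis using that by auto
qed

lemma Phi_real:
  assumes "c > 0" "x > 0"
  shows "Im (Phi c (of_real x)) = 0"
proof -
  have "power_quotient (of_real x) \<in> \<real>"
    using assms powr_of_real[of x \<alpha>] by (auto simp: power_quotient_def intro!: Reals_divide Reals_diff)
  moreover have "of_real c + complex_of_real x = of_real (c + x)" by simp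
  ultimately have "Phi c (of_real x) \<in> \<real>"
    unfolding Phi_def using assms 
    by (intro Reals_divide Reals_mult) (simp_all only: powr_of_real Reals_of_real less_imp_le add_pos_pos)
  thus ?thesis by (simp add: complex_is_Real_iff)
qed

lemma norm_Phi:
  assumes "z \<noteq> 1"
  shows "norm (Phi c z) = norm z powr (\<alpha> - 2) * norm (of_real c + z) powr (1 - \<alpha>)
           * (norm (z - 1) / norm (z powr of_real \<alpha> - 1))"
  using assms
  by (simp add: Phi_def norm_mult norm_divide norm_powr_real_powr' power_quotient_def del: of_real_diff)

text \<open>A bound for \<open>|z \<Phi>(z)|\<close> on the upper half circle of radius \<open>r\<close>, hence
up to the factor \<open>\<pi>\<close> for the change of a primitive along a part of that circle.\<close>

definition arc_bound :: "real \<Rightarrow> real \<Rightarrow> real" where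
  "arc_bound c r = r * (r powr (\<alpha> - 2) * \<bar>c - r\<bar> powr (1 - \<alpha>) * ((1 + r) / \<bar>r powr \<alpha> - 1\<bar>))"

lemma norm_Phi_arc:
  assumes "c > 0" "r > 0" "r \<noteq> 1" "r \<noteq> c" "0 \<le> x" "x \<le> pi"
  shows "r * norm (Phi c (rcis r x)) \<le> arc_bound c r"
proof -
  have n1: "norm (rcis r x - 1) \<le> 1 + r"
    using norm_triangle_ineq4[of "rcis r x" 1] assms by simp
  have ne1: "rcis r x \<noteq> 1"
  proof
    assume "rcis r x = 1"
    hence "norm (rcis r x) = 1" by simp
    thus False using assms by simp
  qed
  have n2: "\<bar>c - r\<bar> \<le> norm (of_real c + rcis r x)"
    using norm_triangle_ineq3[of "of_real c" "- rcis r x"] assms by simp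
  have pz: "rcis r x powr of_real \<alpha> = rcis (r powr \<alpha>) (\<alpha> * x)"
    using assms pi_gt_zero by (intro powr_rcis) linarith+
  have n3: "\<bar>r powr \<alpha> - 1\<bar> \<le> norm (rcis r x powr of_real \<alpha> - 1)"
    using norm_triangle_ineq3[of "rcis (r powr \<alpha>) (\<alpha> * x)" 1] assms by (simp add: pz)
  have "r powr \<alpha> \<noteq> 1"
    using assms alpha_gt_1 by (simp add: powr_def)
  hence pos: "\<bar>r powr \<alpha> - 1\<bar> > 0" by simp
  have n4: "norm (of_real c + rcis r x) powr (1 - \<alpha>) \<le> \<bar>c - r\<bar> powr (1 - \<alpha>)"
    using n2 assms alpha_gt_1 by (intro powr_mono2') auto
  show ?thesis
    unfolding arc_bound_def norm_Phi[OF ne1]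
    using assms n1 n3 n4 pos
    by (intro mult_left_mono mult_mono frac_le) auto
qed

lemma Phi_arc_difference:
  assumes c: "c > 0" and P: "\<And>z. z \<notin> \<real>\<^sub>\<le>\<^sub>0 \<Longrightarrow> (P has_field_derivative Phi c z) (at z)"
    and r: "r > 0" "r \<noteq> 1" "r \<noteq> c" and x: "0 \<le> x" "x < pi"
  shows "norm (P (rcis r x) - P (of_real r)) \<le> pi * arc_bound c r"
proof -
  have "norm (P (rcis r x) - P (rcis r 0)) \<le> arc_bound c r * norm (x - 0)"
  proof (rule differentiable_bound[of "{0..x}"])
    fix t assume t: "t \<in> {0..x}"
    have d: "((\<lambda>t. rcis r t) has_vector_derivative (\<i> * rcis r t)) (at t within {0..x})"
      unfolding rcis_def cis_conv_exp
      by (auto intro!: derivative_eq_intros simp: has_vector_derivative_def[symmetric])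
    have "((P \<circ> rcis r) has_vector_derivative (\<i> * rcis r t * Phi c (rcis r t))) (at t within {0..x})"
      using t x r pi_gt_zero
      by (intro field_vector_diff_chain_within[OF d] has_field_derivative_at_within[OF P] rcis_slit) auto
    thus "((\<lambda>t. P (rcis r t)) has_derivative (\<lambda>h. h *\<^sub>R (\<i> * rcis r t * Phi c (rcis r t)))) (at t within {0..x})"
      by (simp add: has_vector_derivative_def comp_def)
    have "norm (\<i> * rcis r t * Phi c (rcis r t)) \<le> arc_bound c r"
      using norm_Phi_arc[OF c r, of t] t x r by (simp add: norm_mult)
    thus "onorm (\<lambda>h. h *\<^sub>R (\<i> * rcis r t * Phi c (rcis r t))) \<le> arc_bound c r"
      by (subst onorm_scaleR_left) (auto simp: onorm_id)
  qed (use x in auto)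
  also have "\<dots> \<le> arc_bound c r * pi"
    using x norm_Phi_arc[OF c r, of 0] r
    by (intro mult_left_mono) (auto intro: order_trans[rotated])
  finally show ?thesis by (simp add: mult.commute)
qed

lemma primitive_real_axis:
  assumes c: "c > 0" and P: "\<And>z. z \<notin> \<real>\<^sub>\<le>\<^sub>0 \<Longrightarrow> (P has_field_derivative Phi c z) (at z)"
    and r: "r > 0" "s > 0"
  shows "Im (P (of_real r)) = Im (P (of_real s))"
proof -
  have d: "((\<lambda>t. Im (P (of_real t))) has_real_derivative 0) (at t)" if "t > 0" for t
  proof -
    have "(of_real has_vector_derivative (1::complex)) (at t)"
      by (auto intro!: derivative_eq_intros)
    hence "((P \<circ> of_real) has_vector_derivative (1 * Phi c (of_real t))) (at t)"
      using that by (intro field_vector_diff_chain_at P) (auto simp: complex_nonpos_Reals_iff)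
    hence "((\<lambda>t. Im ((P \<circ> of_real) t)) has_vector_derivative Im (Phi c (of_real t))) (at t)"
      by (intro bounded_linear.has_vector_derivative[OF bounded_linear_Im]) (simp add: comp_def)
    thus ?thesis using Phi_real[OF c that]
      by (simp add: has_real_derivative_iff_has_vector_derivative comp_def)
  qed
  have "Im (P (of_real x)) = Im (P (of_real y))" if "0 < x" "x < y" for x y
    
  proof -
    have c: "continuous_on {x..y} (\<lambda>t. Im (P (complex_of_real t)))"
    proof (rule continuous_at_imp_continuous_on, rule ballI)
      fix t assume "t \<in> {x..y}"
      hence "t > 0" using that by simp
      from DERIV_isCont[OF d[OF this]] show "isCont (\<lambda>t. Im (P (complex_of_real t))) t" .
    qed
    have "Im (P (of_real y)) = Im (P (of_real x))"
      by (rule DERIV_isconst_end[of x y "\<lambda>t. Im (P (of_real t))", OF that(2) c d]) (use that in linarith)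
    thus ?thesis by simp
  qed
  note eq = this
  consider "r < s" | "r = s" | "s < r" by linarith
  thus ?thesis
  proof cases
    case 1
    show ?thesis by (rule eq[OF r(1) 1])
  next
    case 3
    show ?thesis by (rule eq[OF r(2) 3, symmetric])
  qed simp
qed

lemma arc_bound_at_infinity: "(arc_bound c \<longlongrightarrow> 0) at_top"
proof -
  have "((\<lambda>r. r * (r powr (\<alpha> - 2) * \<bar>c - r\<bar> powr (1 - \<alpha>) * ((1 + r) / \<bar>r powr \<alpha> - 1\<bar>))) \<longlongrightarrow> 0) at_top"
    using alpha_gt_1 by real_asymp
  thus ?thesis unfolding arc_bound_def [abs_def] .
qed

lemma arc_bound_at_0: "c > 0 \<Longrightarrow> (arc_bound c \<longlongrightarrow> 0) (at_right 0)"
proof -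
  assume "c > 0"
  hence "((\<lambda>r. r * (r powr (\<alpha> - 2) * \<bar>c - r\<bar> powr (1 - \<alpha>) * ((1 + r) / \<bar>r powr \<alpha> - 1\<bar>))) \<longlongrightarrow> 0) (at_right 0)"
    using alpha_gt_1 by real_asymp
  thus ?thesis unfolding arc_bound_def [abs_def] .
qed

text \<open>An integrable majorant, up to a constant, of \<open>\<Phi>\<close> along all rays that are close to
the negative axis.\<close>

definition majorant :: "real \<Rightarrow> real \<Rightarrow> real" where
  "majorant c y = indicator {0<..} y * (y powr (\<alpha> - 2) * \<bar>c - y\<bar> powr (1 - \<alpha>) * ((1 + y) / max 1 (y powr \<alpha>)))"

lemma majorant_factor_le: "y > 0 \<Longrightarrow> (1 + y) / max 1 (y powr \<alpha>) \<le> 2 * min 1 (y powr (1 - \<alpha>))"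
proof (cases "y \<le> 1")
  case True
  assume "y > 0"
  hence "y powr \<alpha> \<le> 1" "1 \<le> y powr (1 - \<alpha>)"
    using True alpha_gt_1 powr_mono2'[of "1 - \<alpha>" y 1] by (auto simp: powr_le1)
  thus ?thesis using True by (simp add: max_def min_def)
next
  case False
  hence y: "y > 1" by simp
  hence 1: "y powr \<alpha> \<ge> 1" using alpha_gt_1 by (simp add: ge_one_powr_ge_zero)
  have "(1 + y) / y powr \<alpha> \<le> (2 * y) / y powr \<alpha>"
    using y by (intro divide_right_mono) auto
  also have "\<dots> = 2 * y powr (1 - \<alpha>)" using y by (simp add: powr_diff)
  finally have 2: "(1 + y) / y powr \<alpha> \<le> 2 * y powr (1 - \<alpha>)" .
  have "y powr (1 - \<alpha>) \<le> y powr 0" using y alpha_gt_1 by (intro powr_mono) auto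
  with 1 2 y show ?thesis using alpha_gt_1 by (simp add: max_def min_def)
qed

lemma majorant_nonneg: "0 \<le> majorant c y"
  by (auto simp: majorant_def indicator_def)

lemma majorant_measurable [measurable]: "majorant c \<in> borel_measurable borel"
  unfolding majorant_def by measurable

text \<open>Up to constants the majorant is a power with exponent \<open>\<alpha> - 2\<close> near
\<open>0\<close>, with exponent \<open>1 - \<alpha>\<close> of the distance near \<open>c\<close>,
and with exponent \<open>-\<alpha>\<close> at infinity; all three are integrable because
\<open>1 < \<alpha> < 2\<close>.\<close>

lemma integrable_majorant:
  assumes c: "c > 0"
  shows "integrable lborel (majorant c)"
proof -
  let ?b = "\<lambda>y. (2 * (c/2) powr (1-\<alpha>)) * (indicator {0<..c/2} y * y powr (\<alpha> - 2))
     + (2 * (c/2) powr (\<alpha>-2)) * (indicator {c - c..c+c} y * \<bar>c-y\<bar> powr (1-\<alpha>))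
     + (2 * (1/2) powr (1-\<alpha>)) * (indicator {2*c..} y * y powr (- \<alpha>))"
  have "integrable lborel ?b"
    using c alpha_gt_1 alpha_lt_2
    by (intro Bochner_Integration.integrable_add integrable_mult_right lborel_powr_near_0 lborel_powr_dist lborel_powr_at_infinity) auto
  moreover have "norm (majorant c y) \<le> norm (?b y)" for y
  proof -
    have p: "0 \<le> (2 * (c/2) powr (1-\<alpha>)) * (indicator {0<..c/2} y * y powr (\<alpha> - 2))"
        "0 \<le> (2 * (c/2) powr (\<alpha>-2)) * (indicator {c - c..c+c} y * \<bar>c-y\<bar> powr (1-\<alpha>))"
        "0 \<le> (2 * (1/2) powr (1-\<alpha>)) * (indicator {2*c..} y * y powr (- \<alpha>))"
      by (auto simp: indicator_def)
    have "majorant c y \<le> ?b y"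
    proof (cases "y > 0")
      case False
      then show ?thesis using p by (simp add: majorant_def)
    next
      case y: True
      define m where "m = (1 + y) / max 1 (y powr \<alpha>)"
      have m: "0 \<le> m" "m \<le> 2" "m \<le> 2 * y powr (1 - \<alpha>)"
        using majorant_factor_le[OF y] y unfolding m_def by auto
      have d: "majorant c y = y powr (\<alpha> - 2) * \<bar>c - y\<bar> powr (1 - \<alpha>) * m"
        using y by (simp add: majorant_def m_def)
      consider "y \<le> c/2" | "c/2 < y" "y < 2*c" | "2*c \<le> y" by linarith
      thus ?thesis
      proof cases
        case 1
        have "\<bar>c - y\<bar> powr (1 - \<alpha>) \<le> (c/2) powr (1-\<alpha>)"
          using 1 c alpha_gt_1 by (intro powr_mono2') auto
        hence "majorant c y \<le> y powr (\<alpha> - 2) * (c/2) powr (1-\<alpha>) * 2"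
          unfolding d using m by (intro mult_mono) auto
        also have "\<dots> = (2 * (c/2) powr (1-\<alpha>)) * (indicator {0<..c/2} y * y powr (\<alpha> - 2))"
          using 1 y by simp
        finally show ?thesis using p by linarith
      next
        case 2
        have "y powr (\<alpha> - 2) \<le> (c/2) powr (\<alpha> - 2)"
          using 2 c alpha_lt_2 by (intro powr_mono2') auto
        hence "majorant c y \<le> (c/2) powr (\<alpha>-2) * \<bar>c-y\<bar> powr (1-\<alpha>) * 2"
          unfolding d using m by (intro mult_mono) auto
        also have "\<dots> = (2 * (c/2) powr (\<alpha>-2)) * (indicator {c - c..c+c} y * \<bar>c-y\<bar> powr (1-\<alpha>))"
          using 2 y by simp
        finally show ?thesis using p by linarith
      next
        case 3
        have "\<bar>c - y\<bar> powr (1 - \<alpha>) \<le> (1/2 * y) powr (1-\<alpha>)"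
          using 3 c alpha_gt_1 by (intro powr_mono2') auto
        hence "majorant c y \<le> y powr (\<alpha> - 2) * (1/2 * y) powr (1-\<alpha>) * (2 * y powr (1-\<alpha>))"
          unfolding d using m by (intro mult_mono) auto
        also have "\<dots> = (2 * (1/2) powr (1-\<alpha>)) * (y powr (\<alpha>-2) * y powr (1-\<alpha>) * y powr (1-\<alpha>))"
          using y by (subst powr_mult) auto
        also have "y powr (\<alpha>-2) * y powr (1-\<alpha>) * y powr (1-\<alpha>) = y powr (-\<alpha>)"
          by (simp only: powr_add[symmetric]) simp
        also have "(2 * (1/2) powr (1-\<alpha>)) * y powr (-\<alpha>) = (2 * (1/2) powr (1-\<alpha>)) * (indicator {2*c..} y * y powr (- \<alpha>))"
          using 3 by simp
        finally show ?thesis using p by linarith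
      qed
    qed
    thus ?thesis using majorant_nonneg[of c y] by simp
  qed
  ultimately show ?thesis
    by (intro Bochner_Integration.integrable_bound[of _ ?b "majorant c"] AE_I2) auto
qed

lemma cos_alpha_pi_less_1: "cos (\<alpha> * pi) < 1"
proof -
  have "cos (\<alpha> * pi) \<noteq> 1"
  proof
    assume "cos (\<alpha> * pi) = 1"
    then obtain n :: int where "\<alpha> * pi = of_int n * (2 * pi)" by (auto simp: cos_one_2pi_int)
    hence "\<alpha> = 2 * of_int n" by simp
    hence "1 < 2 * real_of_int n" "2 * real_of_int n < 2" using alpha_gt_1 alpha_lt_2 by auto
    hence "0 < n" "n < 1" by linarith+
    thus False by simp
  qed
  thus ?thesis using cos_le_one[of "\<alpha> * pi"] by linarith
qed

lemma norm_Phi_le_majorant: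
  assumes "0 < x" "x < pi" "y > 0" "y \<noteq> c" "cos (\<alpha> * x) \<le> k" "0 \<le> k" "k < 1" "c > 0"
  shows "norm (Phi c (rcis y x)) \<le> majorant c y / (1 - k)"
proof -
  have "sin x > 0" using assms by (simp add: sin_gt_zero)
  hence "Im (rcis y x) \<noteq> 0" using assms by simp
  hence ne1: "rcis y x \<noteq> 1" by (auto simp: complex_eq_iff)
  have n1: "norm (rcis y x - 1) \<le> 1 + y"
    using norm_triangle_ineq4[of "rcis y x" 1] assms by simp
  have n2: "\<bar>c - y\<bar> \<le> norm (of_real c + rcis y x)"
    using norm_triangle_ineq3[of "of_real c" "- rcis y x"] assms by simp
  have n4: "norm (of_real c + rcis y x) powr (1 - \<alpha>) \<le> \<bar>c - y\<bar> powr (1 - \<alpha>)"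
    using n2 assms alpha_gt_1 by (intro powr_mono2') auto
  have pz: "rcis y x powr of_real \<alpha> = rcis (y powr \<alpha>) (\<alpha> * x)"
    using assms pi_gt_zero by (intro powr_rcis) linarith+
  have n3: "(1 - k) * max 1 (y powr \<alpha>) \<le> norm (rcis y x powr of_real \<alpha> - 1)"
    unfolding pz using assms by (intro norm_rcis_minus_1_ge) auto
  have pos: "0 < (1 - k) * max 1 (y powr \<alpha>)" using assms by simp
  have "norm (Phi c (rcis y x)) \<le> y powr (\<alpha> - 2) * \<bar>c - y\<bar> powr (1 - \<alpha>) * ((1 + y) / ((1 - k) * max 1 (y powr \<alpha>)))"
    unfolding norm_Phi[OF ne1]
    using assms n1 n3 n4 pos by (intro mult_mono frac_le) auto
  also have "\<dots> = majorant c y / (1 - k)" using assms by (simp add: majorant_def)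
  finally show ?thesis .
qed

text \<open>The difference of the two integrands in the identity
\<open>\<integral>\<^sub>y\<^sub><\<^sub>c v(y) (c - y)^(1 - \<alpha>) dy = \<integral>\<^sub>y\<^sub>>\<^sub>c y^\<alpha> v(y) (y - c)^(1 - \<alpha>) dy\<close>.\<close>

definition balance_kernel :: "real \<Rightarrow> real \<Rightarrow> real" where
  "balance_kernel c y = v_density \<alpha> y * \<bar>c - y\<bar> powr (1 - \<alpha>) * (if y < c then 1 else - (y powr \<alpha>))"

text \<open>On the upper side of the negative axis the powers contribute the angle \<open>\<alpha>\<pi>\<close>
for \<open>y < c\<close>, but the second power turns it into \<open>-\<pi>\<close> for
\<open>y > c\<close>. Multiplied by the conjugate of the denominator this leaves
\<open>sin(\<alpha>\<pi>)\<close> in the first case and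
\<open>-y^\<alpha> sin(\<alpha>\<pi>)\<close> in the second, which is where the weight
\<open>y^\<alpha>\<close> comes from.\<close>

lemma Im_Phi_boundary:
  assumes "c > 0" "y > 0" "y \<noteq> c"
  shows "Im (Phi c (of_real (- y)) * (- 1)) = pi * balance_kernel c y"
proof -
  define A where "A = y powr (\<alpha> - 2) * \<bar>c - y\<bar> powr (1 - \<alpha>) * (1 + y)"
  define s where "s = y powr \<alpha>"
  define D where "D = y powr (2 * \<alpha>) - 2 * y powr \<alpha> * cos (\<alpha> * pi) + 1"
  have D: "D = (s * cos (\<alpha> * pi) - 1)\<^sup>2 + (s * sin (\<alpha> * pi))\<^sup>2"
  proof -
    have "y powr (2 * \<alpha>) = s\<^sup>2"
      unfolding s_def using assms by (simp add: powr_add[symmetric] power2_eq_square)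
    moreover have "(s * cos (\<alpha> * pi) - 1)\<^sup>2 + (s * sin (\<alpha> * pi))\<^sup>2
        = s\<^sup>2 * ((sin (\<alpha> * pi))\<^sup>2 + (cos (\<alpha> * pi))\<^sup>2) - 2 * s * cos (\<alpha> * pi) + 1"
      by algebra
    ultimately show ?thesis unfolding D_def sin_cos_squared_add by (simp add: s_def)
  qed
  have y1: "complex_of_real (- y) \<noteq> 1"
    using assms by (simp add: complex_eq_iff)
  have ym: "complex_of_real (- y) = rcis y pi" by (simp add: rcis_def)
  have p1: "complex_of_real (- y) powr of_real a = rcis (y powr a) (a * pi)" for a
    unfolding ym using assms by (intro powr_rcis) auto
  have p2: "(of_real c + complex_of_real (- y)) powr of_real (1 - \<alpha>)
      = rcis (\<bar>c - y\<bar> powr (1 - \<alpha>)) (if y < c then 0 else (1 - \<alpha>) * pi)"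
  proof (cases "y < c")
    case True
    have eq: "of_real c + complex_of_real (- y) = rcis (c - y) 0" by (simp add: rcis_def)
    show ?thesis unfolding eq using True powr_rcis[of "c - y" 0 "1 - \<alpha>"] by simp
  next
    case False
    hence "of_real c + complex_of_real (- y) = rcis (y - c) pi" by (simp add: rcis_def)
    thus ?thesis using False assms by (simp add: powr_rcis abs_minus_commute del: of_real_diff)
  qed
  define \<phi> where "\<phi> = (\<alpha> - 2) * pi + (if y < c then 0 else (1 - \<alpha>) * pi)"
  have "Phi c (of_real (- y)) * (- 1) = of_real A * (cis \<phi> / (rcis s (\<alpha> * pi) - 1))"
    unfolding Phi_def p1 p2 power_quotient_def if_not_P[OF y1] 
    by (simp add: rcis_def cis_mult A_def s_def \<phi>_def field_simps)
  moreover have "Im (of_real A * z) = A * Im z" for z by simp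
  ultimately have "Im (Phi c (of_real (- y)) * (- 1)) = A * Im (cis \<phi> / (rcis s (\<alpha> * pi) - 1))"
    by (simp only:)
  also have "Im (cis \<phi> / (rcis s (\<alpha> * pi) - 1))
      = (sin \<phi> * (s * cos (\<alpha> * pi) - 1) - cos \<phi> * (s * sin (\<alpha> * pi))) / D"
    by (simp add: Im_divide D)
  also have "sin \<phi> * (s * cos (\<alpha> * pi) - 1) - cos \<phi> * (s * sin (\<alpha> * pi))
      = - sin (\<alpha> * pi) * (if y < c then 1 else - s)"
  proof (cases "y < c")
    case True
    hence "\<phi> = \<alpha> * pi - 2 * pi" by (simp add: \<phi>_def algebra_simps)
    hence "sin \<phi> = sin (\<alpha> * pi)" "cos \<phi> = cos (\<alpha> * pi)" by (simp_all add: sin_diff cos_diff)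
    thus ?thesis using True by (simp add: algebra_simps)
  next
    case False
    hence "\<phi> = - pi" by (simp add: \<phi>_def algebra_simps)
    hence "sin \<phi> = 0" "cos \<phi> = -1" by simp_all
    thus ?thesis using False by simp
  qed
  also have "A * (- sin (\<alpha> * pi) * (if y < c then 1 else - s) / D) = pi * balance_kernel c y"
    using assms unfolding balance_kernel_def v_density_def A_def s_def D_def by (simp add: mult_ac)
  finally show ?thesis .
qed

text \<open>Cauchy's theorem for \<open>\<Phi>\<close> in a sector. The integral along the ray of angle
\<open>x n\<close> from radius \<open>1 / R n\<close> to \<open>R n\<close> is a difference of two
values of a primitive. Moving both end points along circular arcs to the positive axis, where the
primitive has constant imaginary part, costs no more than two arc bounds, which vanish as
\<open>R n\<close> grows. Letting the angle tend to \<open>\<pi>\<close> simultaneously turns the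
rays into the upper side of the negative axis.\<close>

lemma density_balance:
  assumes c: "c > 0"
  shows "integrable lborel (balance_kernel c)" and "(LINT y|lborel. balance_kernel c y) = 0"
proof -
  obtain P where P: "\<And>z. z \<notin> \<real>\<^sub>\<le>\<^sub>0 \<Longrightarrow> (P has_field_derivative Phi c z) (at z)"
    using Phi_primitive[OF c] by blast
  define C where "C = cos (\<alpha> * pi)"
  have "C < 1" "C \<ge> - 1" using cos_alpha_pi_less_1 by (simp_all add: C_def)
  \<comment> \<open>The midpoint of \<open>cos(\<alpha>\<pi>)\<close> and \<open>1\<close> is nonnegative, as the lower bound for \<open>|z^\<alpha> - 1|\<close> requires.\<close>
  moreover define k where "k = (1 + C) / 2"
  ultimately have "0 \<le> k" "k < 1" "C < k" by simp_all
  hence k: "0 \<le> k" "k < 1" "cos (\<alpha> * pi) < k" by (simp_all add: C_def)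
  define x0 where "x0 = (\<lambda>n. pi * (1 - 1 / real (n + 2)))"
  have x0_lim: "x0 \<longlonglongrightarrow> pi" unfolding x0_def by real_asymp
  have x0: "0 < x0 n" "x0 n < pi" for n
  proof -
    have "0 < 1 - 1 / real (n + 2)" "1 - 1 / real (n + 2) < 1" by (auto simp: field_simps)
    thus "0 < x0 n" "x0 n < pi" unfolding x0_def by simp_all
  qed
  have "(\<lambda>n. cos (\<alpha> * x0 n)) \<longlonglongrightarrow> cos (\<alpha> * pi)" by (intro tendsto_intros x0_lim)
  hence "eventually (\<lambda>n. cos (\<alpha> * x0 n) < k) sequentially"
    using k(3) by (rule order_tendstoD(2))
  moreover have "eventually (\<lambda>n. real n > c + 1 / c) sequentially"
    by real_asymp
  ultimately have "eventually (\<lambda>n. cos (\<alpha> * x0 n) < k \<and> real n > c + 1 / c) sequentially"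
    by (rule eventually_conj)
  then obtain N where N: "\<And>n. n \<ge> N \<Longrightarrow> cos (\<alpha> * x0 n) < k \<and> real n > c + 1 / c"
    unfolding eventually_sequentially by blast
  \<comment> \<open>Shifting by \<open>N\<close> makes the estimates hold from the start and keeps the radii \<open>R n\<close> and \<open>1 / R n\<close> away from \<open>c\<close>.\<close>
  define x where "x n = x0 (n + N)" for n
  have x: "0 < x n" "x n < pi" "cos (\<alpha> * x n) \<le> k" for n
    using x0[of "n + N"] N[of "n + N"] by (auto simp: x_def)
  have x_lim: "x \<longlonglongrightarrow> pi" unfolding x_def using x0_lim by (rule LIMSEQ_ignore_initial_segment)
  define R where "R n = real (n + N + 2)" for n
  have R: "R n > 1" "R n \<noteq> c" "1 / R n < 1" "1 / R n \<noteq> c" "1 / R n > 0" for n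
  proof -
    have "R n > c + 1 / c" using N[of "n + N"] by (simp add: R_def)
    moreover have "c + 1 / c > c" "c + 1 / c > 1 / c" using c by auto
    ultimately have "R n > c" "R n > 1 / c" by linarith+
    moreover show "R n > 1" by (simp add: R_def)
    ultimately show "R n \<noteq> c" "1 / R n < 1" "1 / R n \<noteq> c" "1 / R n > 0"
      using c by (auto simp: field_simps)
  qed
  have Rpos: "y > 0" if "1 / R n \<le> y" for n y
    using order.strict_trans2[OF R(5) that] .
  have R_le: "1 / R n \<le> R n" for n
    using R(1,3)[of n] by linarith
  define u where "u n y = indicator {1 / R n..R n} y * Im (Phi c (rcis y (x n)) * cis (x n))" for n y
  have cont: "continuous_on {1 / R n..R n} (\<lambda>y. Phi c (rcis y (x n)) * cis (x n))" for n
  proof -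
    have "continuous_on (- \<real>\<^sub>\<le>\<^sub>0) (Phi c)"
      using holomorphic_Phi[OF c] by (rule holomorphic_on_imp_continuous_on)
    moreover have "continuous_on {1 / R n..R n} (\<lambda>y. rcis y (x n))"
      unfolding rcis_def by (intro continuous_intros)
    moreover have "(\<lambda>y. rcis y (x n)) ` {1 / R n..R n} \<subseteq> - \<real>\<^sub>\<le>\<^sub>0"
    proof (rule image_subsetI)
      fix y assume "y \<in> {1 / R n..R n}"
      hence "y > 0" using Rpos[of n y] by simp
      thus "rcis y (x n) \<in> - \<real>\<^sub>\<le>\<^sub>0" using rcis_slit[of y "x n"] x[of n] pi_gt_zero by simp
    qed
    ultimately have "continuous_on {1 / R n..R n} (\<lambda>y. Phi c (rcis y (x n)))"
      by (rule continuous_on_compose2)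
    thus ?thesis by (intro continuous_intros)
  qed
  have u_int: "(LINT y|lborel. u n y) = Im (P (rcis (R n) (x n)) - P (rcis (1 / R n) (x n)))" for n
  proof -
    have d: "((\<lambda>y. P (rcis y (x n))) has_vector_derivative (Phi c (rcis y (x n)) * cis (x n))) (at y within {1 / R n..R n})"
      if "1 / R n \<le> y" for y
    proof -
      have y: "y > 0" using that R[of n] by linarith
      have "((\<lambda>y. rcis y (x n)) has_vector_derivative cis (x n)) (at y within {1 / R n..R n})"
        unfolding rcis_def by (auto intro!: derivative_eq_intros)
      from field_vector_diff_chain_within[OF this has_field_derivative_at_within[OF P]]
      have "((P \<circ> (\<lambda>y. rcis y (x n))) has_vector_derivative cis (x n) * Phi c (rcis y (x n))) (at y within {1 / R n..R n})"
        using rcis_slit[OF y, of "x n"] x[of n] pi_gt_zero by simp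
      thus ?thesis by (simp add: comp_def mult.commute)
    qed
    have d': "((\<lambda>y. Im (P (rcis y (x n)))) has_vector_derivative Im (Phi c (rcis y (x n)) * cis (x n))) (at y within {1 / R n..R n})"
      if "1 / R n \<le> y" for y
      by (rule bounded_linear.has_vector_derivative[OF bounded_linear_Im d[OF that]])
    have "(LINT y|lborel. indicator {1 / R n..R n} y *\<^sub>R Im (Phi c (rcis y (x n)) * cis (x n)))
       = Im (P (rcis (R n) (x n))) - Im (P (rcis (1 / R n) (x n)))"
      by (intro integral_FTC_atLeastAtMost d' R_le continuous_on_Im cont)
    thus ?thesis by (simp add: u_def)
  qed
  have u_meas: "u n \<in> borel_measurable lborel" for n
  proof -
    have "set_integrable lborel {1 / R n..R n} (\<lambda>y. Im (Phi c (rcis y (x n)) * cis (x n)))"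
      by (intro borel_integrable_atLeastAtMost' continuous_intros cont)
    thus ?thesis unfolding set_integrable_def u_def [abs_def] by (auto dest: borel_measurable_integrable)
  qed
  have u_bound: "norm (u n y) \<le> majorant c y / (1 - k)" if "y \<noteq> c" for n y
  proof (cases "y \<in> {1 / R n..R n}")
    case True
    hence y: "y > 0" using Rpos[of n y] by simp
    have "\<bar>Im (Phi c (rcis y (x n)) * cis (x n))\<bar> \<le> norm (Phi c (rcis y (x n)) * cis (x n))"
      by (rule abs_Im_le_cmod)
    also have "\<dots> = norm (Phi c (rcis y (x n)))" by (simp add: norm_mult)
    also have "\<dots> \<le> majorant c y / (1 - k)"
      using x[of n] y that k c by (intro norm_Phi_le_majorant)
    finally show ?thesis using True by (simp add: u_def)
  qed (use k majorant_nonneg[of c y] in \<open>auto simp: u_def\<close>)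
  have u_lim: "(\<lambda>n. u n y) \<longlonglongrightarrow> pi * balance_kernel c y" if "y \<noteq> c" for y
  proof (cases "y > 0")
    case True
    have z_lim: "(\<lambda>n. rcis y (x n)) \<longlonglongrightarrow> of_real (- y)"
    proof -
      have "(\<lambda>n. of_real y * cis (x n)) \<longlonglongrightarrow> of_real y * cis pi"
        by (intro tendsto_intros tendsto_cis x_lim)
      thus ?thesis by (simp add: rcis_def)
    qed
    have im: "Im (rcis y (x n)) > 0" for n
      using True x[of n] by (simp add: sin_gt_zero)
    have m1: "complex_of_real (- y) \<noteq> 1" using True by (simp add: complex_eq_iff)
    have quotient_eq: "power_quotient (rcis y (x n)) = (rcis y (x n) powr of_real \<alpha> - 1) / (rcis y (x n) - 1)" for n
    proof -
      have "rcis y (x n) \<noteq> 1" using im[of n] by (metis one_complex.sel(2) less_irrefl)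
      thus ?thesis by (simp add: power_quotient_def)
    qed
    have pow_lim: "(\<lambda>n. rcis y (x n) powr of_real a) \<longlonglongrightarrow> of_real (- y) powr of_real a" for a
      using True by (intro tendsto_powr_upper z_lim im) auto
    have "(\<lambda>n. of_real c + rcis y (x n)) \<longlonglongrightarrow> of_real c + of_real (- y)"
      by (intro tendsto_intros z_lim)
    hence c_lim: "(\<lambda>n. (of_real c + rcis y (x n)) powr of_real (1 - \<alpha>)) \<longlonglongrightarrow> of_real (c - y) powr of_real (1 - \<alpha>)"
      using im that by (intro tendsto_powr_upper) auto
    have q0: "power_quotient (of_real (- y)) \<noteq> 0"
    proof -
      have "complex_of_real (- y) = rcis y pi" by (simp add: rcis_def)
      hence "complex_of_real (- y) powr of_real \<alpha> = rcis (y powr \<alpha>) (\<alpha> * pi)"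
        using True by (simp add: powr_rcis)
      moreover have "norm (rcis (y powr \<alpha>) (\<alpha> * pi) - 1) \<ge> (1 - k) * max 1 (y powr \<alpha>)"
        using k by (intro norm_rcis_minus_1_ge) auto
      moreover have "(1 - k) * max 1 (y powr \<alpha>) > 0" using k by simp
      ultimately have "complex_of_real (- y) powr of_real \<alpha> - 1 \<noteq> 0" by auto
      thus ?thesis using m1 by (simp add: power_quotient_def)
    qed
    have "(\<lambda>n. power_quotient (rcis y (x n))) \<longlonglongrightarrow> power_quotient (of_real (- y))"
      unfolding quotient_eq if_not_P[OF m1] power_quotient_def[of "of_real (- y)"] using m1
      by (intro tendsto_intros pow_lim z_lim) simp
    hence "(\<lambda>n. Phi c (rcis y (x n))) \<longlonglongrightarrow> Phi c (of_real (- y))"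
      unfolding Phi_def using c_lim q0 by (intro tendsto_divide tendsto_mult pow_lim) simp_all
    moreover have "(\<lambda>n. cis (x n)) \<longlonglongrightarrow> - 1"
      using tendsto_cis[OF x_lim] by simp
    ultimately have "(\<lambda>n. Im (Phi c (rcis y (x n)) * cis (x n))) \<longlonglongrightarrow> Im (Phi c (of_real (- y)) * (- 1))"
      by (intro tendsto_Im tendsto_mult)
    hence lim: "(\<lambda>n. Im (Phi c (rcis y (x n)) * cis (x n))) \<longlonglongrightarrow> pi * balance_kernel c y"
      unfolding Im_Phi_boundary[OF c True that] .
    have "eventually (\<lambda>n. y < R n \<and> 1 / y < R n) sequentially"
      unfolding R_def by (intro eventually_conj; real_asymp)
    hence "eventually (\<lambda>n. Im (Phi c (rcis y (x n)) * cis (x n)) = u n y) sequentially"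
    proof eventually_elim
      case (elim n)
      hence "y \<in> {1 / R n..R n}" using True R[of n] by (auto simp: field_simps)
      thus ?case by (simp add: u_def)
    qed
    from Lim_transform_eventually[OF lim this] show ?thesis .
  next
    case False
    hence "y \<notin> {1 / R n..R n}" for n using Rpos[of n y] by auto
    thus ?thesis using False by (simp add: u_def balance_kernel_def v_density_def)
  qed
  have ae: "AE y in lborel. y \<noteq> c" by (rule AE_lborel_singleton)
  have w: "integrable lborel (\<lambda>y. majorant c y / (1 - k))"
    by (intro integrable_divide integrable_majorant c)
  have km: "(\<lambda>y. pi * balance_kernel c y) \<in> borel_measurable lborel"
    unfolding balance_kernel_def v_density_def by measurable
  have lim_ae: "AE y in lborel. (\<lambda>n. u n y) \<longlonglongrightarrow> pi * balance_kernel c y"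
    using ae by eventually_elim (rule u_lim)
  have bd_ae: "AE y in lborel. norm (u n y) \<le> majorant c y / (1 - k)" for n
    using ae by eventually_elim (rule u_bound)
  have "integrable lborel (\<lambda>y. pi * balance_kernel c y)"
    by (rule integrable_dominated_convergence[OF km u_meas w lim_ae bd_ae])
  thus "integrable lborel (balance_kernel c)" by simp
  have conv: "(\<lambda>n. LINT y|lborel. u n y) \<longlonglongrightarrow> (LINT y|lborel. pi * balance_kernel c y)"
    by (rule integral_dominated_convergence[OF km u_meas w lim_ae bd_ae])
  have le: "\<bar>LINT y|lborel. u n y\<bar> \<le> pi * (arc_bound c (R n) + arc_bound c (1 / R n))" for n
  proof -
    let ?a = "P (rcis (R n) (x n)) - P (of_real (R n))"
    let ?b = "P (rcis (1 / R n) (x n)) - P (of_real (1 / R n))"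
    have "Im (P (of_real (R n))) = Im (P (of_real (1 / R n)))"
      by (rule primitive_real_axis[OF c P]) (use R[of n] in auto)
    hence "(LINT y|lborel. u n y) = Im ?a - Im ?b" by (simp add: u_int)
    moreover have "\<bar>Im ?a\<bar> \<le> pi * arc_bound c (R n)"
      by (rule order_trans[OF abs_Im_le_cmod Phi_arc_difference[OF c P]]) (use R[of n] x[of n] in auto)
    moreover have "\<bar>Im ?b\<bar> \<le> pi * arc_bound c (1 / R n)"
      by (rule order_trans[OF abs_Im_le_cmod Phi_arc_difference[OF c P]]) (use R[of n] x[of n] in auto)
    ultimately show ?thesis by (simp add: algebra_simps)
  qed
  have "(\<lambda>n. pi * (arc_bound c (R n) + arc_bound c (1 / R n))) \<longlonglongrightarrow> pi * (0 + 0)"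
  proof -
    have "filterlim R at_top sequentially" unfolding R_def by real_asymp
    moreover have "filterlim (\<lambda>n. 1 / R n) (at_right 0) sequentially" unfolding R_def by real_asymp
    ultimately show ?thesis
      using arc_bound_at_infinity[of c] arc_bound_at_0[OF c]
      by (intro tendsto_intros filterlim_compose[of "arc_bound c" _ _ R] filterlim_compose[of "arc_bound c" _ _ "\<lambda>n. 1 / R n"])
  qed
  hence "(\<lambda>n. pi * (arc_bound c (R n) + arc_bound c (1 / R n))) \<longlonglongrightarrow> 0" by simp
  hence "(\<lambda>n. LINT y|lborel. u n y) \<longlonglongrightarrow> 0"
    by (rule Lim_null_comparison[OF always_eventually[OF allI], rotated]) (use le in simp)
  hence "(LINT y|lborel. pi * balance_kernel c y) = 0" using conv LIMSEQ_unique by blast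
  thus "(LINT y|lborel. balance_kernel c y) = 0" by simp
qed

section \<open>The density and the two kernels\<close>

abbreviation v :: "real \<Rightarrow> real" where "v \<equiv> v_density \<alpha>"

lemma v_measurable [measurable]: "v \<in> borel_measurable borel"
  unfolding v_density_def by measurable

lemma v_eq_0 [simp]: "y \<le> 0 \<Longrightarrow> v y = 0"
  by (simp add: v_density_def)

lemma denominator_eq:
  assumes "y > 0"
  shows "y powr (2 * \<alpha>) - 2 * y powr \<alpha> * cos (\<alpha> * pi) + 1 = (norm (rcis (y powr \<alpha>) (\<alpha> * pi) - 1))\<^sup>2"
proof -
  have "y powr (2 * \<alpha>) = (y powr \<alpha>)\<^sup>2"
    using assms by (simp add: powr_add[symmetric] power2_eq_square)
  thus ?thesis by (simp add: norm_rcis_minus_1)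
qed

lemma v_nonneg [simp]: "0 \<le> v y"
proof (cases "y > 0")
  case True
  have "0 \<le> sin (pi * \<alpha> - pi)"
    using alpha_gt_1 alpha_lt_2 by (intro sin_ge_zero) (auto simp: algebra_simps)
  hence "0 \<le> - sin (pi * \<alpha>)" by (simp add: sin_diff)
  thus ?thesis unfolding v_density_def denominator_eq[OF True] if_P[OF True]
    by (intro divide_nonneg_nonneg mult_nonneg_nonneg) (use True in auto)
qed simp

text \<open>The density is of order \<open>y^(\<alpha> - 2)\<close> at \<open>0\<close> and of order
\<open>y^(- \<alpha> - 1)\<close> at infinity, so that \<open>\<alpha> > 1\<close> makes the mean
finite.\<close>

lemma v_moments:
  shows integrable_v: "integrable lborel v"
    and integrable_v_mean: "integrable lborel (\<lambda>y. v y * y)"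
proof -
  define k where "k = max 0 (cos (\<alpha> * pi))"
  have k: "0 \<le> k" "k < 1" "cos (\<alpha> * pi) \<le> k"
    using cos_alpha_pi_less_1 by (auto simp: k_def)
  define A where "A = - sin (pi * \<alpha>) / (pi * (1 - k)\<^sup>2)"
  let ?b = "\<lambda>y. 2 * \<bar>A\<bar> * (indicator {0<..1} y * y powr (\<alpha> - 2) + indicator {1..} y * y powr (- \<alpha>))"
  have b: "integrable lborel ?b"
    using alpha_gt_1 by (intro integrable_mult_right Bochner_Integration.integrable_add lborel_powr_near_0 lborel_powr_at_infinity) auto
  have le: "v y \<le> ?b y \<and> v y * y \<le> ?b y" if y: "y > 0" for y
  proof -
    define m where "m = max 1 (y powr \<alpha>)"
    define D where "D = y powr (2 * \<alpha>) - 2 * y powr \<alpha> * cos (\<alpha> * pi) + 1"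
    have "(1 - k) * m \<le> norm (rcis (y powr \<alpha>) (\<alpha> * pi) - 1)"
      unfolding m_def using k by (intro norm_rcis_minus_1_ge) auto
    hence D: "((1 - k) * m)\<^sup>2 \<le> D"
      unfolding D_def denominator_eq[OF y] using k by (intro power_mono) (auto simp: m_def)
    have pos: "0 < (1 - k) * m" using k by (simp add: m_def)
    have D0: "D > 0" using zero_less_power[OF pos, of 2] D by (rule less_le_trans)
    have "v y = (- sin (pi * \<alpha>) / pi) * (y powr (\<alpha> - 2) * ((1 + y) / D))"
      using y by (simp add: v_density_def D_def)
    also have "\<dots> \<le> \<bar>- sin (pi * \<alpha>) / pi\<bar> * (y powr (\<alpha> - 2) * ((1 + y) / ((1 - k) * m)\<^sup>2))"
      using D y D0 zero_less_power[OF pos, of 2] by (intro mult_mono[OF abs_ge_self] mult_left_mono frac_le)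
        (auto simp: D0 less_imp_le[OF D0])
    also have "\<dots> = \<bar>A\<bar> * (y powr (\<alpha> - 2) * ((1 + y) / m / m))"
      using k by (simp add: A_def power2_eq_square abs_mult)
    also have "\<dots> \<le> \<bar>A\<bar> * (y powr (\<alpha> - 2) * (2 * min 1 (y powr (1 - \<alpha>)) / m))"
      using majorant_factor_le[OF y] by (intro mult_left_mono divide_right_mono) (auto simp: m_def)
    finally have vle: "v y \<le> 2 * \<bar>A\<bar> * (y powr (\<alpha> - 2) * (min 1 (y powr (1 - \<alpha>)) / m))" by (simp add: mult_ac)
    show ?thesis
    proof (cases "y \<le> 1")
      case True
      have "min 1 (y powr (1 - \<alpha>)) / m \<le> 1 / 1"
        by (intro frac_le) (auto simp: m_def)
      hence "2 * \<bar>A\<bar> * (y powr (\<alpha> - 2) * (min 1 (y powr (1 - \<alpha>)) / m)) \<le> 2 * \<bar>A\<bar> * (y powr (\<alpha> - 2) * 1)"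
        by (intro mult_left_mono) auto
      also have "\<dots> \<le> ?b y"
        using True y by (intro mult_left_mono) (auto simp: indicator_def)
      finally have "v y \<le> ?b y" using vle by linarith
      moreover have "v y * y \<le> v y * 1" using True y by (intro mult_left_mono) auto
      ultimately show ?thesis by linarith
    next
      case False
      hence y1: "y > 1" by simp
      have "min 1 (y powr (1 - \<alpha>)) / m \<le> y powr (1 - \<alpha>) / y powr \<alpha>"
        using y by (intro frac_le) (auto simp: m_def)
      hence "2 * \<bar>A\<bar> * (y powr (\<alpha> - 2) * (min 1 (y powr (1 - \<alpha>)) / m))
         \<le> 2 * \<bar>A\<bar> * (y powr (\<alpha> - 2) * (y powr (1 - \<alpha>) / y powr \<alpha>))"
        by (intro mult_left_mono) auto
      hence "v y * y \<le> 2 * \<bar>A\<bar> * (y powr (\<alpha> - 2) * (y powr (1 - \<alpha>) / y powr \<alpha>)) * y"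
        using vle y by (intro mult_right_mono) auto
      also have "\<dots> = 2 * \<bar>A\<bar> * (y powr (\<alpha> - 2) * y powr (1 - \<alpha>) * y powr (- \<alpha>) * y powr 1)"
        using y by (simp add: powr_minus divide_inverse)
      also have "y powr (\<alpha> - 2) * y powr (1 - \<alpha>) * y powr (- \<alpha>) * y powr 1 = y powr (- \<alpha>)"
        by (simp only: powr_add[symmetric]) simp
      also have "2 * \<bar>A\<bar> * y powr (- \<alpha>) = ?b y" using y1 by simp
      finally have "v y * y \<le> ?b y" .
      moreover have "v y * 1 \<le> v y * y" using y1 by (intro mult_left_mono) auto
      ultimately show ?thesis by linarith
    qed
  qed
  have b0: "0 \<le> ?b y" for y by (auto simp: indicator_def)
  have *: "norm (v y) \<le> norm (?b y) \<and> norm (v y * y) \<le> norm (?b y)" for y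
  proof (cases "y > 0")
    case True
    have "norm (v y) = v y" "norm (v y * y) = v y * y" "norm (?b y) = ?b y"
      using True b0[of y] by (simp_all only: real_norm_def abs_of_nonneg v_nonneg mult_nonneg_nonneg less_imp_le)
    thus ?thesis using le[OF True] by simp
  qed simp
  show "integrable lborel v"
    using * by (intro Bochner_Integration.integrable_bound[OF b] AE_I2) auto
  show "integrable lborel (\<lambda>y. v y * y)"
    using * by (intro Bochner_Integration.integrable_bound[OF b] AE_I2) auto
qed

text \<open>The kernel by which the right-hand side of the commutation rule at \<open>r\<close> is an integral
of the second derivative of the test function. It is supported on \<open>u > r y\<close>;
\<open>K2\<close> is the counterpart supported on \<open>u < r y\<close>.\<close>

definition K1 :: "real \<Rightarrow> real \<Rightarrow> real \<Rightarrow> real" where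
  "K1 r y u = (if 0 < y \<and> 0 < u \<and> r * y < u then v y * (u - r * y) powr (1 - \<alpha>) else 0)"

definition K2 :: "real \<Rightarrow> real \<Rightarrow> real \<Rightarrow> real" where
  "K2 r y u = (if 0 < y \<and> 0 < u \<and> u < r * y then v y * y powr \<alpha> * (r * y - u) powr (1 - \<alpha>) else 0)"

lemma K_measurable [measurable]:
  "case_prod (K1 r) \<in> borel_measurable (borel \<Otimes>\<^sub>M borel)"
  "case_prod (K2 r) \<in> borel_measurable (borel \<Otimes>\<^sub>M borel)"
  unfolding K1_def K2_def by measurable

lemma K_nonneg: "0 \<le> K1 r y u" "0 \<le> K2 r y u"
  by (auto simp: K1_def K2_def)

text \<open>The identity for the density at \<open>c = u / r\<close>, rescaled.\<close>

lemma K_balance: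
  assumes r: "r > 0"
  shows "(\<integral>\<^sup>+y. ennreal (K1 r y u) \<partial>lborel) = (\<integral>\<^sup>+y. ennreal (K2 r y u) \<partial>lborel)"
proof (cases "u > 0")
  case False
  thus ?thesis by (simp add: K1_def K2_def)
next
  case u: True
  define c where "c = u / r"
  have c: "c > 0" using u r by (simp add: c_def)
  have sc: "\<bar>u - r * y\<bar> powr (1 - \<alpha>) = r powr (1 - \<alpha>) * \<bar>c - y\<bar> powr (1 - \<alpha>)" for y
  proof -
    have "u - r * y = r * (c - y)" using r by (simp add: c_def algebra_simps)
    thus ?thesis using r by (simp add: abs_mult powr_mult)
  qed
  have k1: "K1 r y u = r powr (1 - \<alpha>) * (indicator {..<c} y * balance_kernel c y)" for y
  proof (cases "0 < y \<and> y < c")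
    case True
    hence *: "r * y < u" using r by (simp add: c_def field_simps)
    have "(u - r * y) powr (1 - \<alpha>) = r powr (1 - \<alpha>) * \<bar>c - y\<bar> powr (1 - \<alpha>)"
      using sc[of y] * by simp
    thus ?thesis using * True u by (simp add: K1_def balance_kernel_def)
  next
    case False
    hence "K1 r y u = 0" using r by (auto simp: K1_def c_def field_simps)
    moreover have "indicator {..<c} y * balance_kernel c y = 0"
      using False by (cases "y > 0") (auto simp: balance_kernel_def)
    ultimately show ?thesis by simp
  qed
  have k2: "K2 r y u = r powr (1 - \<alpha>) * (indicator {..<c} y * balance_kernel c y - balance_kernel c y)" for y
  proof (cases "c < y")
    case True
    hence *: "u < r * y" using r by (simp add: c_def field_simps)
    have "(r * y - u) powr (1 - \<alpha>) = r powr (1 - \<alpha>) * \<bar>c - y\<bar> powr (1 - \<alpha>)"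
      using sc[of y] * by simp
    moreover have "y > 0" using True c by simp
    ultimately show ?thesis using * True u by (simp add: K2_def balance_kernel_def)
  next
    case False
    hence "K2 r y u = 0" using r by (auto simp: K2_def c_def field_simps)
    moreover have "indicator {..<c} y * balance_kernel c y - balance_kernel c y = 0"
      using False by (cases "y = c") (auto simp: balance_kernel_def)
    ultimately show ?thesis by simp
  qed
  have int1: "integrable lborel (\<lambda>y. indicator {..<c} y * balance_kernel c y)"
    using integrable_real_mult_indicator[OF _ density_balance(1)[OF c], of "{..<c}"] by (simp add: mult.commute)
  have i1: "integrable lborel (\<lambda>y. K1 r y u)" and i2: "integrable lborel (\<lambda>y. K2 r y u)"
    unfolding k1 k2 using int1 density_balance(1)[OF c] by (auto intro!: integrable_mult_right Bochner_Integration.integrable_diff)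
  have "(LINT y|lborel. K1 r y u) = (LINT y|lborel. K2 r y u)"
    unfolding k1 k2 using int1 density_balance[OF c] by (simp add: Bochner_Integration.integral_diff)
  thus ?thesis
    using i1 i2 by (simp add: nn_integral_eq_integral K_nonneg)
qed

end

section \<open>Fractional integrals of a decaying test function\<close>

text \<open>A test function together with its first two derivatives. The functions live on the whole line only
for the sake of measurability; away from the half-line nothing is assumed but continuity. The
exponent \<open>\<gamma> > 2 - \<alpha>\<close> makes the right-sided fractional integrals converge.\<close>

locale decaying_test = stable_index +
  fixes f0 f1 f2 :: "real \<Rightarrow> real" and \<gamma> C :: real
  assumes gamma: "\<gamma> > 2 - \<alpha>"
    and continuous: "continuous_on UNIV f0" "continuous_on UNIV f1" "continuous_on UNIV f2"
    and deriv_f0: "\<And>x. x > 0 \<Longrightarrow> (f0 has_real_derivative f1 x) (at x)"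
    and deriv_f1: "\<And>x. x > 0 \<Longrightarrow> (f1 has_real_derivative f2 x) (at x)"
    and decay: "\<And>x. x \<ge> 0 \<Longrightarrow> \<bar>f0 x\<bar> \<le> C * (1 + x) powr (- \<gamma>)"
      "\<And>x. x \<ge> 0 \<Longrightarrow> \<bar>f1 x\<bar> \<le> C * (1 + x) powr (- \<gamma>)"
      "\<And>x. x \<ge> 0 \<Longrightarrow> \<bar>f2 x\<bar> \<le> C * (1 + x) powr (- \<gamma>)"
    and f1_0: "f1 0 = 0"
begin

definition weight :: "real \<Rightarrow> real" where "weight s = indicator {0<..} s * s powr (1 - \<alpha>)"

definition b :: "real \<Rightarrow> real" where "b x = C * (1 + x) powr (- \<gamma>)"

text \<open>\<open>g\<close> is \<open>D^\<alpha>_-\<close> of the test function without the Gamma factor, and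
\<open>H\<close> is the multiplicative kernel applied to it; \<open>G\<close> is the derivative of
the multiplicative kernel of the test function. \<open>Q\<close> and \<open>W\<close> are left-sided
fractional integrals of the second and the first derivative. The modulus in \<open>g\<close> makes
it continuous and bounded on the whole line.\<close>

definition g :: "real \<Rightarrow> real" where "g x = (LINT s|lborel. f2 (\<bar>x\<bar> + s) * weight s)"

definition H :: "real \<Rightarrow> real" where "H r = (LINT y|lborel. v y * g (r * y))"

definition Q :: "real \<Rightarrow> real" where "Q z = (LINT u|lborel. indicator {0<..<z} u * f2 u * (z - u) powr (1 - \<alpha>))"

definition W :: "real \<Rightarrow> real" where "W z = (LINT u|lborel. indicator {0<..<z} u * f1 u * (z - u) powr (1 - \<alpha>))"

definition G :: "real \<Rightarrow> real" where "G t = (LINT y|lborel. v y * y * f1 (t * y))"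

lemma f_measurable [measurable]:
  "f0 \<in> borel_measurable borel" "f1 \<in> borel_measurable borel" "f2 \<in> borel_measurable borel"
  using continuous by (auto intro: borel_measurable_continuous_onI)

lemma weight_measurable [measurable]: "weight \<in> borel_measurable borel"
  unfolding weight_def by measurable

lemma weight_nonneg [simp]: "0 \<le> weight s" by (simp add: weight_def)

lemma gamma_pos: "\<gamma> > 0" using gamma alpha_lt_2 by linarith

lemma C_nonneg: "0 \<le> C" using decay(1)[of 0] by simp

lemma b_nonneg [simp]: "0 \<le> b x" using C_nonneg by (simp add: b_def)

lemma b_le_C: "0 \<le> x \<Longrightarrow> b x \<le> C"
  using powr_mono2'[of "- \<gamma>" 1 "1 + x"] gamma_pos C_nonneg
  unfolding b_def by (intro mult_left_le) auto

lemma b_measurable [measurable]: "b \<in> borel_measurable borel"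
  unfolding b_def by measurable

lemma b_antimono: "0 \<le> x \<Longrightarrow> x \<le> y \<Longrightarrow> b y \<le> b x"
  unfolding b_def using C_nonneg gamma_pos by (intro mult_left_mono powr_mono2') auto

lemma abs_le_b:
  assumes "0 \<le> s" "s \<le> x"
  shows "\<bar>f0 x\<bar> \<le> b s" "\<bar>f1 x\<bar> \<le> b s" "\<bar>f2 x\<bar> \<le> b s"
  using decay[of x] b_antimono[of s x] assms unfolding b_def by auto

lemma abs_le_C:
  assumes "0 \<le> x"
  shows "\<bar>f0 x\<bar> \<le> C" "\<bar>f1 x\<bar> \<le> C" "\<bar>f2 x\<bar> \<le> C"
  using abs_le_b[of 0 x] b_le_C[of 0] assms by auto

lemma integrable_b_weight: "integrable lborel (\<lambda>s. b s * weight s)"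
proof (rule Bochner_Integration.integrable_bound)
  show "integrable lborel (\<lambda>s. C * (indicator {0<..1} s * s powr (1 - \<alpha>) + indicator {1..} s * s powr (1 - \<alpha> - \<gamma>)))"
    using alpha_lt_2 gamma
    by (intro integrable_mult_right Bochner_Integration.integrable_add lborel_powr_near_0 lborel_powr_at_infinity) auto
  show "AE s in lborel. norm (b s * weight s) \<le>
      norm (C * (indicator {0<..1} s * s powr (1 - \<alpha>) + indicator {1..} s * s powr (1 - \<alpha> - \<gamma>)))"
  proof (rule AE_I2)
    fix s :: real
    consider "s \<le> 0" | "0 < s" "s \<le> 1" | "1 < s" by linarith
    thus "norm (b s * weight s) \<le>
      norm (C * (indicator {0<..1} s * s powr (1 - \<alpha>) + indicator {1..} s * s powr (1 - \<alpha> - \<gamma>)))"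
    proof cases
      case 2
      have "b s * s powr (1 - \<alpha>) \<le> C * s powr (1 - \<alpha>)"
        using b_le_C[of s] 2 by (intro mult_right_mono) auto
      also have "\<dots> \<le> C * (s powr (1 - \<alpha>) + indicator {1..} s * s powr (1 - \<alpha> - \<gamma>))"
        using C_nonneg by (intro mult_left_mono) auto
      finally show ?thesis using 2 C_nonneg by (simp add: weight_def abs_mult)
    next
      case 3
      have "(1 + s) powr (- \<gamma>) \<le> s powr (- \<gamma>)"
        using 3 gamma_pos by (intro powr_mono2') auto
      hence "(1 + s) powr (- \<gamma>) * s powr (1 - \<alpha>) \<le> s powr (- \<gamma>) * s powr (1 - \<alpha>)"
        by (intro mult_right_mono) auto
      also have "\<dots> = s powr (1 - \<alpha> - \<gamma>)" by (simp add: powr_add[symmetric])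
      finally have "C * ((1 + s) powr (- \<gamma>) * s powr (1 - \<alpha>)) \<le> C * s powr (1 - \<alpha> - \<gamma>)"
        using C_nonneg by (intro mult_left_mono)
      thus ?thesis using 3 C_nonneg by (simp add: weight_def b_def abs_mult mult_ac)
    qed (simp add: weight_def)
  qed
qed measurable

definition N :: ennreal where "N = (\<integral>\<^sup>+s. ennreal (b s * weight s) \<partial>lborel)"

lemma N_finite: "N < \<infinity>"
  using integrable_b_weight unfolding N_def real_integrable_def by (simp add: top.not_eq_extremum)

lemma integrable_shift:
  assumes "x \<ge> 0"
  shows "integrable lborel (\<lambda>s. f0 (x + s) * weight s)" "integrable lborel (\<lambda>s. f1 (x + s) * weight s)"
    "integrable lborel (\<lambda>s. f2 (x + s) * weight s)"
proof -
  have le: "norm (f (x + s) * weight s) \<le> norm (b s * weight s)"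
    if "\<And>x s. 0 \<le> s \<Longrightarrow> s \<le> x \<Longrightarrow> \<bar>f x\<bar> \<le> b s" for f s
    using that[of s "x + s"] assms by (cases "s > 0") (auto simp: abs_mult weight_def intro!: mult_right_mono)
  show "integrable lborel (\<lambda>s. f0 (x + s) * weight s)" "integrable lborel (\<lambda>s. f1 (x + s) * weight s)"
    "integrable lborel (\<lambda>s. f2 (x + s) * weight s)"
    by (intro Bochner_Integration.integrable_bound[OF integrable_b_weight] AE_I2 le abs_le_b; simp)+
qed

lemma abs_shift_le: "x \<ge> 0 \<Longrightarrow> \<bar>f2 (x + s) * weight s\<bar> \<le> b s * weight s"
  using abs_le_b(3)[of s "x + s"] by (cases "s > 0") (auto simp: abs_mult weight_def intro!: mult_right_mono)

lemma K1_inner: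
  assumes "r > 0"
  shows "(LINT u|lborel. K1 r y u * f2 u) = v y * g (r * y)"
    and "(\<integral>\<^sup>+u. ennreal (K1 r y u * \<bar>f2 u\<bar>) \<partial>lborel) \<le> ennreal (v y) * N"
proof -
  have eq: "K1 r y (r * y + s) = v y * weight s" if "y > 0" for s
    using that assms by (cases "s > 0") (auto simp: K1_def weight_def add_pos_pos)
  show "(LINT u|lborel. K1 r y u * f2 u) = v y * g (r * y)"
  proof (cases "y > 0")
    case True
    have "(LINT u|lborel. K1 r y u * f2 u) = (LINT s|lborel. K1 r y (r * y + 1 * s) * f2 (r * y + 1 * s))"
      by (subst lborel_integral_real_affine[where c = 1 and t = "r * y"]) auto
    also have "\<dots> = (LINT s|lborel. v y * (f2 (\<bar>r * y\<bar> + s) * weight s))"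
      using True assms by (intro Bochner_Integration.integral_cong) (auto simp: eq)
    finally show ?thesis by (simp add: g_def)
  qed (simp add: K1_def)
  show "(\<integral>\<^sup>+u. ennreal (K1 r y u * \<bar>f2 u\<bar>) \<partial>lborel) \<le> ennreal (v y) * N"
  proof (cases "y > 0")
    case True
    have "(\<integral>\<^sup>+u. ennreal (K1 r y u * \<bar>f2 u\<bar>) \<partial>lborel)
        = (\<integral>\<^sup>+s. ennreal (K1 r y (r * y + 1 * s) * \<bar>f2 (r * y + 1 * s)\<bar>) \<partial>lborel)"
      by (subst nn_integral_real_affine[where c = 1 and t = "r * y"]) auto
    also have "\<dots> \<le> (\<integral>\<^sup>+s. ennreal (v y * (b s * weight s)) \<partial>lborel)"
    proof (intro nn_integral_mono ennreal_leI)
      fix s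
      have "\<bar>f2 (r * y + s) * weight s\<bar> \<le> b s * weight s"
        using True assms by (intro abs_shift_le) auto
      hence "v y * \<bar>f2 (r * y + s) * weight s\<bar> \<le> v y * (b s * weight s)"
        by (intro mult_left_mono) auto
      thus "K1 r y (r * y + 1 * s) * \<bar>f2 (r * y + 1 * s)\<bar> \<le> v y * (b s * weight s)"
        by (simp add: eq[OF True] abs_mult mult_ac)
    qed
    also have "\<dots> = ennreal (v y) * N"
      by (simp add: ennreal_mult' nn_integral_cmult N_def)
    finally show ?thesis .
  qed (simp add: K1_def)
qed

lemma K2_inner:
  "(LINT u|lborel. K2 r y u * f2 u) = v y * y powr \<alpha> * Q (r * y)"
proof (cases "y > 0")
  case True
  have "(LINT u|lborel. K2 r y u * f2 u)
     = (LINT u|lborel. v y * y powr \<alpha> * (indicator {0<..<r * y} u * f2 u * (r * y - u) powr (1 - \<alpha>)))"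
    using True by (intro Bochner_Integration.integral_cong) (auto simp: K2_def indicator_def)
  thus ?thesis by (simp add: Q_def)
qed (simp add: K2_def)

lemma K1_total_le:
  assumes "r > 0"
  shows "(\<integral>\<^sup>+y. \<integral>\<^sup>+u. ennreal (K1 r y u * \<bar>f2 u\<bar>) \<partial>lborel \<partial>lborel) \<le> (\<integral>\<^sup>+y. ennreal (v y) \<partial>lborel) * N"
proof -
  have "(\<integral>\<^sup>+y. \<integral>\<^sup>+u. ennreal (K1 r y u * \<bar>f2 u\<bar>) \<partial>lborel \<partial>lborel) \<le> (\<integral>\<^sup>+y. ennreal (v y) * N \<partial>lborel)"
    by (intro nn_integral_mono K1_inner assms)
  also have "\<dots> = (\<integral>\<^sup>+y. ennreal (v y) \<partial>lborel) * N" by (simp add: nn_integral_multc)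
  finally show ?thesis .
qed

lemma total_finite: "(\<integral>\<^sup>+y. ennreal (v y) \<partial>lborel) * N < \<infinity>"
  using integrable_v N_finite unfolding real_integrable_def
  by (simp add: ennreal_mult_less_top top.not_eq_extremum)

text \<open>The exchange of kernels: averaging the right-sided integral of the second derivative against the
density gives the same as averaging its left-sided integral with the additional weight
\<open>y^\<alpha>\<close>.\<close>

lemma H_eq:
  assumes r: "r > 0"
  shows "H r = (LINT y|lborel. v y * y powr \<alpha> * Q (r * y))"
proof -
  have "(LINT y|lborel. LINT u|lborel. K1 r y u * f2 u) = (LINT y|lborel. LINT u|lborel. K2 r y u * f2 u)"
    by (rule kernel_swap_integral)
       (auto simp: K_nonneg K_balance[OF r] intro: le_less_trans[OF K1_total_le[OF r] total_finite, simplified])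
  thus ?thesis by (simp add: K1_inner[OF r] K2_inner H_def)
qed

text \<open>The left-sided kernel inherits absolute convergence, uniformly in \<open>r\<close>, from the
right-sided one. A direct estimate would be harder, as the density has no second moment.\<close>

lemma K2_total_le:
  assumes r: "r > 0"
  shows "(\<integral>\<^sup>+y. ennreal (v y * y powr \<alpha> * \<bar>Q (r * y)\<bar>) \<partial>lborel) \<le> (\<integral>\<^sup>+y. ennreal (v y) \<partial>lborel) * N"
proof -
  have "ennreal (v y * y powr \<alpha> * \<bar>Q (r * y)\<bar>) \<le> (\<integral>\<^sup>+u. ennreal (K2 r y u * \<bar>f2 u\<bar>) \<partial>lborel)" for y
  proof -
    have "ennreal (v y * y powr \<alpha> * \<bar>Q (r * y)\<bar>) = ennreal \<bar>LINT u|lborel. K2 r y u * f2 u\<bar>"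
      by (simp add: K2_inner abs_mult)
    also have "\<dots> \<le> (\<integral>\<^sup>+u. ennreal (norm (K2 r y u * f2 u)) \<partial>lborel)"
      using integral_norm_bound_ennreal[of lborel "\<lambda>u. K2 r y u * f2 u"]
      by (cases "integrable lborel (\<lambda>u. K2 r y u * f2 u)") (auto simp: not_integrable_integral_eq)
    finally show ?thesis by (simp add: abs_mult K_nonneg)
  qed
  hence "(\<integral>\<^sup>+y. ennreal (v y * y powr \<alpha> * \<bar>Q (r * y)\<bar>) \<partial>lborel)
      \<le> (\<integral>\<^sup>+y. \<integral>\<^sup>+u. ennreal (K2 r y u * \<bar>f2 u\<bar>) \<partial>lborel \<partial>lborel)"
    by (intro nn_integral_mono)
  also have "\<dots> = (\<integral>\<^sup>+y. \<integral>\<^sup>+u. ennreal (K1 r y u * \<bar>f2 u\<bar>) \<partial>lborel \<partial>lborel)"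
    by (rule kernel_swap_nn[symmetric]) (auto simp: K_nonneg K_balance[OF r])
  finally show ?thesis using K1_total_le[OF r] by (rule order_trans)
qed

lemma f1_increment:
  assumes "0 \<le> x" "x \<le> y"
  shows "(LINT t|lborel. indicator {x..y} t * f2 t) = f1 y - f1 x"
proof -
  have "(LINT t|lborel. indicator {x..y} t *\<^sub>R f2 t) = f1 y - f1 x"
  proof -
    have "(f2 has_integral (f1 y - f1 x)) {x..y}"
      using assms continuous(2)
      by (intro fundamental_theorem_of_calculus_interior)
         (auto intro: continuous_on_subset simp: has_real_derivative_iff_has_vector_derivative[symmetric] deriv_f1)
    moreover have "set_integrable lborel {x..y} f2"
      by (intro borel_integrable_atLeastAtMost' continuous_on_subset[OF continuous(3)]) auto
    ultimately show ?thesis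
      unfolding set_lebesgue_integral_def[symmetric]
      by (metis has_integral_set_lebesgue set_borel_integral_eq_integral(2) integral_unique)
  qed
  thus ?thesis by simp
qed

text \<open>Fractional integration commutes with ordinary integration, and the first derivative is the primitive
of the second one because it vanishes at \<open>0\<close>. This is the only use of that boundary
condition.\<close>

lemma W_eq:
  assumes w: "w > 0"
  shows "W w = (LINT z|lborel. indicator {0<..<w} z * Q z)"
proof -
  \<comment> \<open>The substitution \<open>u = z - s\<close> moves the singularity to the variable \<open>s\<close>, so that the inner integral over \<open>z\<close> is elementary.\<close>
  define F where "F z s = indicator {0<..<w} z * (indicator {0<..<z} s * f2 (z - s) * s powr (1 - \<alpha>))" for z s
  have [measurable]: "case_prod F \<in> borel_measurable (borel \<Otimes>\<^sub>M borel)"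
  proof -
    have "case_prod F = (\<lambda>(z, s). if 0 < s \<and> s < z \<and> z < w then f2 (z - s) * s powr (1 - \<alpha>) else 0)"
      by (auto simp: F_def fun_eq_iff indicator_def)
    thus ?thesis by simp
  qed
  have int: "integrable (lborel \<Otimes>\<^sub>M lborel) (case_prod F)"
  proof (rule Bochner_Integration.integrable_bound)
    have i1: "integrable lborel (\<lambda>z. indicator {0<..<w} z * C :: real)"
      by (intro integrable_mult_left integrable_real_indicator) (auto simp: emeasure_lborel_Ioo w less_imp_le)
    have i2: "integrable lborel (\<lambda>s. indicator {0<..w} s * s powr (1 - \<alpha>))"
      using alpha_lt_2 w by (intro lborel_powr_near_0) auto
    show "integrable (lborel \<Otimes>\<^sub>M lborel) (\<lambda>(z, s). (indicator {0<..<w} z * C) * (indicator {0<..w} s * s powr (1 - \<alpha>)))"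
      by (rule integrable_lborel_prod[OF i1 i2])
    show "AE x in lborel \<Otimes>\<^sub>M lborel. norm (case_prod F x) \<le>
        norm (case x of (z, s) \<Rightarrow> (indicator {0<..<w} z * C) * (indicator {0<..w} s * s powr (1 - \<alpha>)))"
    proof (rule AE_I2)
      fix p :: "real \<times> real"
      obtain z s where p: "p = (z, s)" by (cases p)
      show "norm (case_prod F p) \<le>
        norm (case p of (z, s) \<Rightarrow> (indicator {0<..<w} z * C) * (indicator {0<..w} s * s powr (1 - \<alpha>)))"
        unfolding p using abs_le_C(3)[of "z - s"] C_nonneg
        by (auto simp: F_def indicator_def abs_mult intro!: mult_right_mono)
    qed
  qed measurable
  have 1: "(LINT s|lborel. F z s) = indicator {0<..<w} z * Q z" for z
  proof -
    have "Q z = (LINT s|lborel. indicator {0<..<z} (z + (-1) * s) * f2 (z + (-1) * s) * (z - (z + (-1) * s)) powr (1 - \<alpha>))"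
      unfolding Q_def by (subst lborel_integral_real_affine[where c = "-1" and t = z]) auto
    also have "\<dots> = (LINT s|lborel. indicator {0<..<z} s * f2 (z - s) * s powr (1 - \<alpha>))"
      by (intro Bochner_Integration.integral_cong) (auto simp: indicator_def)
    finally show ?thesis by (simp add: F_def)
  qed
  have 2: "(LINT z|lborel. F z s) = indicator {0<..<w} s * f1 (w - s) * s powr (1 - \<alpha>)" for s
  proof (cases "0 < s \<and> s < w")
    case False
    hence "F z s = 0" for z by (auto simp: F_def indicator_def)
    thus ?thesis using False by (auto simp: indicator_def)
  next
    case True
    have "(LINT z|lborel. F z s) = (LINT t|lborel. F (s + 1 * t) s)"
      by (subst lborel_integral_real_affine[where c = 1 and t = s]) auto
    also have "\<dots> = (LINT t|lborel. s powr (1 - \<alpha>) * (indicator {0..w - s} t * f2 t))"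
      by (rule integral_discrete_difference[where X = "{0, w - s}"])
         (use True in \<open>auto simp: F_def indicator_def\<close>)
    also have "\<dots> = s powr (1 - \<alpha>) * (f1 (w - s) - f1 0)"
      using True by (simp add: f1_increment)
    finally show ?thesis using True by (simp add: f1_0)
  qed
  have "W w = (LINT s|lborel. indicator {0<..<w} (w + (-1) * s) * f1 (w + (-1) * s) * (w - (w + (-1) * s)) powr (1 - \<alpha>))"
    unfolding W_def by (subst lborel_integral_real_affine[where c = "-1" and t = w]) auto
  also have "\<dots> = (LINT s|lborel. LINT z|lborel. F z s)"
    unfolding 2 by (intro Bochner_Integration.integral_cong) (auto simp: indicator_def)
  also have "\<dots> = (LINT z|lborel. LINT s|lborel. F z s)"
    by (rule lborel_pair.Fubini_integral[OF int])
  finally show ?thesis by (simp add: 1)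
qed

lemma Q_measurable [measurable]: "Q \<in> borel_measurable borel"
proof -
  have "Q = (\<lambda>z. LINT u|lborel. (if 0 < u \<and> u < z then f2 u * (z - u) powr (1 - \<alpha>) else 0))"
    unfolding Q_def by (intro ext Bochner_Integration.integral_cong) (auto simp: indicator_def)
  thus ?thesis by simp
qed

lemma H_integral:
  assumes x: "x > 0"
  shows "(LINT r|lborel. indicator {0<..<x} r * H r) = (LINT y|lborel. v y * y powr (\<alpha> - 1) * W (x * y))"
proof -
  define F where "F r y = indicator {0<..<x} r * (v y * y powr \<alpha> * Q (r * y))" for r y
  have [measurable]: "case_prod F \<in> borel_measurable (borel \<Otimes>\<^sub>M borel)"
    unfolding F_def by measurable
  have int: "integrable (lborel \<Otimes>\<^sub>M lborel) (case_prod F)"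
  proof (rule integrableI_bounded)
    have "(\<integral>\<^sup>+ p. ennreal (norm (case_prod F p)) \<partial>(lborel \<Otimes>\<^sub>M lborel)) = (\<integral>\<^sup>+r. \<integral>\<^sup>+y. ennreal (norm (F r y)) \<partial>lborel \<partial>lborel)"
      by (subst lborel.nn_integral_fst[symmetric]) auto
    also have "\<dots> \<le> (\<integral>\<^sup>+r. indicator {0<..<x} r * ((\<integral>\<^sup>+y. ennreal (v y) \<partial>lborel) * N) \<partial>lborel)"
    proof (rule nn_integral_mono)
      fix r :: real
      show "(\<integral>\<^sup>+y. ennreal (norm (F r y)) \<partial>lborel) \<le> indicator {0<..<x} r * ((\<integral>\<^sup>+y. ennreal (v y) \<partial>lborel) * N)"
        using K2_total_le[of r] by (cases "r \<in> {0<..<x}") (auto simp: F_def abs_mult)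
    qed
    also have "\<dots> = ennreal x * ((\<integral>\<^sup>+y. ennreal (v y) \<partial>lborel) * N)"
      using x by (simp add: nn_integral_multc)
    also have "\<dots> < \<infinity>" using total_finite by (simp add: ennreal_mult_less_top)
    finally show "(\<integral>\<^sup>+ p. ennreal (norm (case_prod F p)) \<partial>(lborel \<Otimes>\<^sub>M lborel)) < \<infinity>" .
  qed measurable
  have 1: "(LINT y|lborel. F r y) = indicator {0<..<x} r * H r" for r
    by (cases "r \<in> {0<..<x}") (auto simp: F_def H_eq)
  have 2: "(LINT r|lborel. F r y) = v y * y powr (\<alpha> - 1) * W (x * y)" for y
  proof (cases "y > 0")
    case False
    thus ?thesis by (simp add: F_def)
  next
    case y: True
    have "W (x * y) = y * (LINT r|lborel. indicator {0<..<x * y} (0 + y * r) * Q (0 + y * r))"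
      using x y unfolding W_eq[OF mult_pos_pos[OF x y]]
      by (subst lborel_integral_real_affine[where c = y and t = 0]) auto
    also have "(LINT r|lborel. indicator {0<..<x * y} (0 + y * r) * Q (0 + y * r)) = (LINT r|lborel. indicator {0<..<x} r * Q (r * y))"
      using y by (intro Bochner_Integration.integral_cong) (auto simp: indicator_def zero_less_mult_iff mult.commute)
    finally have "v y * y powr (\<alpha> - 1) * W (x * y) = v y * (y powr (\<alpha> - 1) * y) * (LINT r|lborel. indicator {0<..<x} r * Q (r * y))"
      by simp
    also have "y powr (\<alpha> - 1) * y = y powr \<alpha>"
      using y by (simp add: powr_diff)
    also have "v y * y powr \<alpha> * (LINT r|lborel. indicator {0<..<x} r * Q (r * y)) = (LINT r|lborel. F r y)"
      unfolding F_def by (subst integral_mult_right_zero[symmetric]) (simp add: mult_ac)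
    finally show ?thesis by simp
  qed
  show ?thesis
    using lborel_pair.Fubini_integral[OF int] by (simp add: 1 2)
qed

text \<open>Homogeneity: the substitution \<open>u = t y\<close> turns the weight
\<open>y^(\<alpha> - 1)\<close> into the factor \<open>y\<close> that comes from differentiating
under the multiplicative kernel.\<close>

lemma W_scale:
  assumes y: "y > 0"
  shows "y powr (\<alpha> - 1) * W (x * y) = (LINT t|lborel. y * (indicator {0<..<x} t * f1 (t * y) * (x - t) powr (1 - \<alpha>)))"
proof -
  have "W (x * y) = y * (LINT t|lborel. indicator {0<..<x * y} (0 + y * t) * f1 (0 + y * t) * (x * y - (0 + y * t)) powr (1 - \<alpha>))"
    using y unfolding W_def by (subst lborel_integral_real_affine[where c = y and t = 0]) auto
  also have "(LINT t|lborel. indicator {0<..<x * y} (0 + y * t) * f1 (0 + y * t) * (x * y - (0 + y * t)) powr (1 - \<alpha>))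
     = (LINT t|lborel. y powr (1 - \<alpha>) * (indicator {0<..<x} t * f1 (t * y) * (x - t) powr (1 - \<alpha>)))"
    (is "_ = (LINT t|lborel. _ * ?h t)")
  proof (intro Bochner_Integration.integral_cong refl)
    fix t
    have "(x * y - (0 + y * t)) powr (1 - \<alpha>) = y powr (1 - \<alpha>) * (x - t) powr (1 - \<alpha>)" if "t < x"
    proof -
      have "x * y - (0 + y * t) = y * (x - t)" by (simp add: algebra_simps)
      thus ?thesis using y that by (simp add: powr_mult)
    qed
    thus "indicator {0<..<x * y} (0 + y * t) * f1 (0 + y * t) * (x * y - (0 + y * t)) powr (1 - \<alpha>)
      = y powr (1 - \<alpha>) * (indicator {0<..<x} t * f1 (t * y) * (x - t) powr (1 - \<alpha>))"
      using y by (auto simp: indicator_def zero_less_mult_iff mult.commute)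
  qed
  also have "\<dots> = y powr (1 - \<alpha>) * (LINT t|lborel. ?h t)" by (rule integral_mult_right_zero)
  finally have "y powr (\<alpha> - 1) * W (x * y) = (y powr (\<alpha> - 1) * y powr (1 - \<alpha>)) * (y * (LINT t|lborel. indicator {0<..<x} t * f1 (t * y) * (x - t) powr (1 - \<alpha>)))"
    by (simp only: mult_ac)
  also have "y powr (\<alpha> - 1) * y powr (1 - \<alpha>) = 1" using y by (simp add: powr_add[symmetric])
  finally show ?thesis by simp
qed

lemma integrable_dist_powr: "x > 0 \<Longrightarrow> integrable lborel (\<lambda>t. indicator {0<..<x} t * (x - t) powr (1 - \<alpha>))"
proof -
  assume x: "x > 0"
  have "integrable lborel (\<lambda>t. indicator {x - x..x + x} t * \<bar>x - t\<bar> powr (1 - \<alpha>))"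
    using x alpha_lt_2 by (intro lborel_powr_dist) auto
  thus ?thesis
    by (rule Bochner_Integration.integrable_bound) (auto simp: indicator_def)
qed

lemma G_integral:
  assumes x: "x > 0"
  shows "(LINT y|lborel. v y * y powr (\<alpha> - 1) * W (x * y)) = (LINT t|lborel. indicator {0<..<x} t * (G t * (x - t) powr (1 - \<alpha>)))"
proof -
  define F where "F y t = v y * y * (indicator {0<..<x} t * f1 (t * y) * (x - t) powr (1 - \<alpha>))" for y t
  have [measurable]: "case_prod F \<in> borel_measurable (borel \<Otimes>\<^sub>M borel)"
    unfolding F_def by measurable
  have int: "integrable (lborel \<Otimes>\<^sub>M lborel) (case_prod F)"
  proof (rule Bochner_Integration.integrable_bound)
    show "integrable (lborel \<Otimes>\<^sub>M lborel) (\<lambda>(y, t). (v y * y) * (C * (indicator {0<..<x} t * (x - t) powr (1 - \<alpha>))))"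
      by (intro integrable_lborel_prod integrable_v_mean integrable_mult_right integrable_dist_powr x)
    show "AE p in lborel \<Otimes>\<^sub>M lborel. norm (case_prod F p) \<le>
        norm (case p of (y, t) \<Rightarrow> (v y * y) * (C * (indicator {0<..<x} t * (x - t) powr (1 - \<alpha>))))"
    proof (rule AE_I2)
      fix p :: "real \<times> real"
      obtain y t where p: "p = (y, t)" by (cases p)
      have "norm (F y t) \<le> norm ((v y * y) * (C * (indicator {0<..<x} t * (x - t) powr (1 - \<alpha>))))"
      proof (cases "0 < y \<and> 0 < t")
        case True
        have "\<bar>v y * y\<bar> * (indicator {0<..<x} t * \<bar>f1 (t * y)\<bar> * (x - t) powr (1 - \<alpha>)) \<le>
           \<bar>v y * y\<bar> * (indicator {0<..<x} t * C * (x - t) powr (1 - \<alpha>))"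
          using True abs_le_C(2)[of "t * y"] by (intro mult_left_mono mult_right_mono) auto
        thus ?thesis using C_nonneg by (simp add: F_def abs_mult mult_ac)
      next
        case False
        hence "F y t = 0" by (cases "y > 0") (auto simp: F_def)
        thus ?thesis by simp
      qed
      thus "norm (case_prod F p) \<le>
        norm (case p of (y, t) \<Rightarrow> (v y * y) * (C * (indicator {0<..<x} t * (x - t) powr (1 - \<alpha>))))"
        by (simp add: p)
    qed
  qed measurable
  have 1: "(LINT t|lborel. F y t) = v y * y powr (\<alpha> - 1) * W (x * y)" for y
  proof (cases "y > 0")
    case True
    have "(LINT t|lborel. F y t) = v y * (LINT t|lborel. y * (indicator {0<..<x} t * f1 (t * y) * (x - t) powr (1 - \<alpha>)))"
      unfolding F_def by (simp add: mult.assoc)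
    thus ?thesis using W_scale[OF True, of x] by (simp add: mult.assoc)
  qed (simp add: F_def)
  have 2: "(LINT y|lborel. F y t) = indicator {0<..<x} t * (G t * (x - t) powr (1 - \<alpha>))" for t
  proof -
    have "(LINT y|lborel. F y t) = (LINT y|lborel. (v y * y * f1 (t * y)) * (indicator {0<..<x} t * (x - t) powr (1 - \<alpha>)))"
      unfolding F_def by (intro Bochner_Integration.integral_cong) auto
    thus ?thesis by (simp add: G_def)
  qed
  show ?thesis
    using lborel_pair.Fubini_integral[OF int] by (simp add: 1 2)
qed

text \<open>The integrated form of the commutation rule. It avoids the second derivative of the multiplicative
kernel, which may be singular at \<open>0\<close>.\<close>

lemma fractional_integral_identity:
  "x > 0 \<Longrightarrow> (LINT t|lborel. indicator {0<..<x} t * (G t * (x - t) powr (1 - \<alpha>))) = (LINT r|lborel. indicator {0<..<x} r * H r)"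
  by (simp only: H_integral G_integral)

section \<open>Differentiation and the commutation rule\<close>

definition R0 :: "real \<Rightarrow> real" where "R0 x = (LINT s|lborel. f0 (x + s) * weight s)"

definition R1 :: "real \<Rightarrow> real" where "R1 x = (LINT s|lborel. f1 (x + s) * weight s)"

definition R2 :: "real \<Rightarrow> real" where "R2 x = (LINT s|lborel. f2 (x + s) * weight s)"

lemma R_deriv:
  assumes x: "x > 0"
  shows "(R0 has_real_derivative R1 x) (at x)" and "(R1 has_real_derivative R2 x) (at x)"
proof -
  have *: "((\<lambda>x. LINT s|lborel. p (x + s) * weight s) has_real_derivative (LINT s|lborel. p' (x + s) * weight s)) (at x)"
    if [measurable]: "p \<in> borel_measurable borel" "p' \<in> borel_measurable borel"
      and p: "\<And>x. x > 0 \<Longrightarrow> (p has_real_derivative p' x) (at x)"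
      and le: "\<And>s x. 0 \<le> s \<Longrightarrow> s \<le> x \<Longrightarrow> \<bar>p' x\<bar> \<le> b s"
      and int: "\<And>x. x \<ge> 0 \<Longrightarrow> integrable lborel (\<lambda>s. p (x + s) * weight s)" for p p'
  proof (rule has_derivative_under_integral[where d = x and B = "\<lambda>s. b s * weight s"])
    fix t assume t: "\<bar>t - x\<bar> < x"
    hence t0: "t > 0" by linarith
    show "integrable lborel (\<lambda>s. p (t + s) * weight s)" using int t0 by simp
    fix s :: real
    show "((\<lambda>t. p (t + s) * weight s) has_real_derivative p' (t + s) * weight s) (at t)"
    proof (cases "s > 0")
      case True
      have "((\<lambda>t. p (t + s)) has_real_derivative p' (t + s)) (at t)"
        using p[of "t + s"] True t0 by (simp add: DERIV_shift)
      thus ?thesis by (rule DERIV_cmult_right)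
    qed (simp add: weight_def)
    show "\<bar>p' (t + s) * weight s\<bar> \<le> b s * weight s"
      using le[of s "t + s"] t0 by (cases "s > 0") (auto simp: abs_mult weight_def intro!: mult_right_mono)
  qed (use x integrable_b_weight in simp_all)
  show "(R0 has_real_derivative R1 x) (at x)"
    unfolding R0_def [abs_def] R1_def
    by (rule *) (auto intro: deriv_f0 abs_le_b integrable_shift)
  show "(R1 has_real_derivative R2 x) (at x)"
    unfolding R1_def [abs_def] R2_def
    by (rule *) (auto intro: deriv_f1 abs_le_b integrable_shift)
qed

lemma isCont_g: "isCont g x"
  unfolding isCont_def g_def
proof (rule dominated_convergence_at[where B = "\<lambda>s. b s * weight s"])
  show "((\<lambda>t. f2 (\<bar>t\<bar> + s) * weight s) \<longlongrightarrow> f2 (\<bar>x\<bar> + s) * weight s) (at x)" for s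
    using continuous(3) by (intro tendsto_intros isCont_tendsto_compose[of _ f2]) (auto simp: continuous_on_eq_continuous_at)
  show "\<forall>\<^sub>F t in at x. \<forall>s\<in>space lborel. \<bar>f2 (\<bar>t\<bar> + s) * weight s\<bar> \<le> b s * weight s"
    by (intro always_eventually allI ballI abs_shift_le) simp
qed (auto simp: integrable_b_weight)

lemma g_measurable [measurable]: "g \<in> borel_measurable borel"
  by (intro borel_measurable_continuous_onI continuous_at_imp_continuous_on ballI isCont_g)

lemma abs_g_le: "\<bar>g x\<bar> \<le> (LINT s|lborel. b s * weight s)"
proof -
  have "norm (g x) \<le> (LINT s|lborel. b s * weight s)"
    unfolding g_def by (rule Bochner_Integration.integral_norm_bound_integral) (auto simp: integrable_b_weight integrable_shift abs_shift_le)
  thus ?thesis by simp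
qed

lemma isCont_H: "isCont H x"
  unfolding isCont_def H_def
proof (rule dominated_convergence_at[where B = "\<lambda>y. v y * (LINT s|lborel. b s * weight s)"])
  show "((\<lambda>t. v y * g (t * y)) \<longlongrightarrow> v y * g (x * y)) (at x)" for y
    by (intro tendsto_intros isCont_tendsto_compose[OF isCont_g])
  show "\<forall>\<^sub>F t in at x. \<forall>y\<in>space lborel. \<bar>v y * g (t * y)\<bar> \<le> v y * (LINT s|lborel. b s * weight s)"
    by (intro always_eventually allI ballI) (auto simp: abs_mult intro!: mult_left_mono abs_g_le)
qed (auto simp: integrable_v)

lemma H_antiderivative:
  assumes x: "x > 0"
  shows "((\<lambda>x. LINT r|lborel. indicator {0<..<x} r * H r) has_real_derivative H x) (at x)"
proof -
  have cont: "continuous_on S H" for S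
    by (intro continuous_at_imp_continuous_on ballI isCont_H)
  have "((\<lambda>x. integral {0..x} H) has_real_derivative H x) (at x within {0..x + 1})"
    by (rule integral_has_real_derivative[OF cont]) (use x in auto)
  moreover have "at x within {0..x + 1} = at x"
    using x by (intro at_within_interior) auto
  ultimately have "((\<lambda>x. integral {0..x} H) has_real_derivative H x) (at x)" by simp
  thus ?thesis
  proof (rule has_field_derivative_transform_within_open[where S = "{0<..}"])
    fix x :: real assume "x \<in> {0<..}"
    hence "integral {0..x} H = (LINT r:{0..x}|lborel. H r)"
      by (intro set_borel_integral_eq_integral(2)[symmetric] borel_integrable_atLeastAtMost' cont)
    also have "\<dots> = (LINT r|lborel. indicator {0<..<x} r * H r)"
      unfolding set_lebesgue_integral_def
      by (rule integral_discrete_difference[where X = "{0, x}"]) (auto simp: indicator_def)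
    finally show "integral {0..x} H = (LINT r|lborel. indicator {0<..<x} r * H r)" .
  qed (use x in auto)
qed

lemma G_deriv:
  assumes x: "x > 0"
  shows "((\<lambda>x. LINT y|lborel. v y * f0 (x * y)) has_real_derivative G x) (at x)"
  unfolding G_def
proof (rule has_derivative_under_integral[where d = x and B = "\<lambda>y. v y * y * C"])
  fix t assume t: "\<bar>t - x\<bar> < x"
  hence t0: "t > 0" by linarith
  show "integrable lborel (\<lambda>y. v y * f0 (t * y))"
  proof (rule Bochner_Integration.integrable_bound[of _ "\<lambda>y. v y * C"])
    show "AE y in lborel. norm (v y * f0 (t * y)) \<le> norm (v y * C)"
    proof (rule AE_I2)
      fix y show "norm (v y * f0 (t * y)) \<le> norm (v y * C)"
        using abs_le_C(1)[of "t * y"] t0 C_nonneg by (cases "y > 0") (auto simp: abs_mult intro!: mult_left_mono)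
    qed
  qed (auto simp: integrable_v)
  fix y :: real
  show "((\<lambda>t. v y * f0 (t * y)) has_real_derivative v y * y * f1 (t * y)) (at t)"
  proof (cases "y > 0")
    case True
    have "(f0 has_real_derivative f1 (t * y)) (at (t * y))" using True t0 by (intro deriv_f0) simp
    hence "((\<lambda>t. f0 (t * y)) has_real_derivative f1 (t * y) * y) (at t)"
      by (rule DERIV_chain2) (auto intro!: derivative_eq_intros)
    hence "((\<lambda>t. v y * f0 (t * y)) has_real_derivative v y * (f1 (t * y) * y)) (at t)"
      by (rule DERIV_cmult)
    thus ?thesis by (simp add: mult_ac)
  qed simp
  show "\<bar>v y * y * f1 (t * y)\<bar> \<le> v y * y * C"
    using abs_le_C(2)[of "t * y"] t0 by (cases "y > 0") (auto simp: abs_mult intro!: mult_left_mono)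
qed (use x integrable_v_mean in simp_all)

lemma G_measurable [measurable]: "G \<in> borel_measurable borel"
  unfolding G_def by measurable

lemma abs_G_le: "0 \<le> t \<Longrightarrow> \<bar>G t\<bar> \<le> (LINT y|lborel. v y * y) * C"
proof -
  assume t: "0 \<le> t"
  have *: "norm (v y * y * f1 (t * y)) \<le> v y * y * C" for y
    using abs_le_C(2)[of "t * y"] t by (cases "y > 0") (auto simp: abs_mult intro!: mult_left_mono)
  have "norm (G t) \<le> (LINT y|lborel. v y * y * C)"
    unfolding G_def
  proof (rule Bochner_Integration.integral_norm_bound_integral)
    show "integrable lborel (\<lambda>y. v y * y * f1 (t * y))"
      using * by (intro Bochner_Integration.integrable_bound[OF integrable_mult_left[OF integrable_v_mean, of C]] AE_I2) (auto intro: order_trans[OF _ abs_ge_self])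
  qed (use * in \<open>auto intro!: integrable_v_mean\<close>)
  thus ?thesis by simp
qed

lemma commutation:
  fixes M :: "'a measure" and V :: "'a \<Rightarrow> real" and f :: "real \<Rightarrow> real"
  assumes V: "\<And>w. w \<in> space M \<Longrightarrow> 0 < V w"
    and distr: "distributed M lborel V (\<lambda>t. ennreal (v_density \<alpha> t))"
    and f: "\<And>x. x \<ge> 0 \<Longrightarrow> f x = f0 x"
  shows "mult_kernel_defined M V f \<and> Delta_plus_defined \<alpha> (mult_kernel M V f) \<and>
         RL_right_defined \<alpha> f \<and> mult_kernel_defined M V (RL_right \<alpha> f) \<and>
         (\<forall>x>0. Delta_plus \<alpha> (mult_kernel M V f) x = mult_kernel M V (RL_right \<alpha> f) x)"
proof -
  let ?\<Gamma> = "Gamma (2 - \<alpha>)"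
  have lbe: "(\<integral>w. p (V w) \<partial>M) = (LINT y|lborel. v y * p y)"
    and lbi: "integrable M (\<lambda>w. p (V w)) \<longleftrightarrow> integrable lborel (\<lambda>y. v y * p y)"
    if "p \<in> borel_measurable borel" for p :: "real \<Rightarrow> real"
    using distributed_integral[OF distr, of p] distributed_integrable[OF distr, of p] that by auto
  have bounded_int: "integrable lborel (\<lambda>y. v y * p (x * y))"
    if [measurable]: "p \<in> borel_measurable borel" and p: "\<And>z. z \<ge> 0 \<Longrightarrow> \<bar>p z\<bar> \<le> K" and x: "x > 0" for p K and x :: real
  proof (rule Bochner_Integration.integrable_bound[of _ "\<lambda>y. v y * K"])
    have "\<bar>p 0\<bar> \<le> K" by (rule p) simp
    hence "K \<ge> 0" by linarith
    show "AE y in lborel. norm (v y * p (x * y)) \<le> norm (v y * K)"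
    proof (rule AE_I2)
      fix y show "norm (v y * p (x * y)) \<le> norm (v y * K)"
        using p[of "x * y"] x \<open>K \<ge> 0\<close> by (cases "y > 0") (auto simp: abs_mult intro!: mult_left_mono)
    qed
  qed (auto simp: integrable_v)

  have right_int: "RL_right_int \<alpha> f x = R0 x / ?\<Gamma>"
    and right_integrable: "set_integrable lborel {x..} (\<lambda>t. f t * (t - x) powr (1 - \<alpha>) / ?\<Gamma>)" if x: "x > 0" for x
  proof -
    have eq: "indicator {x..} t *\<^sub>R (f t * (t - x) powr (1 - \<alpha>) / ?\<Gamma>) = f0 (x + (- x + 1 * t)) * weight (- x + 1 * t) / ?\<Gamma>" for t
      using x f[of t] by (auto simp: weight_def indicator_def)
    show "set_integrable lborel {x..} (\<lambda>t. f t * (t - x) powr (1 - \<alpha>) / ?\<Gamma>)"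
      unfolding set_integrable_def eq
      by (intro lborel_integrable_real_affine[where f = "\<lambda>s. f0 (x + s) * weight s / ?\<Gamma>"] integrable_divide integrable_shift) (use x in auto)
    show "RL_right_int \<alpha> f x = R0 x / ?\<Gamma>"
      unfolding RL_right_int_def set_lebesgue_integral_def eq R0_def
      by (subst lborel_integral_real_affine[where c = 1 and t = "- x"]) auto
  qed
  have right_deriv: "(RL_right_int \<alpha> f has_real_derivative R1 x / ?\<Gamma>) (at x)" if x: "x > 0" for x
    by (rule has_field_derivative_transform_within_open[where S = "{0<..}", OF DERIV_cdivide[OF R_deriv(1)[OF x]]])
       (use x right_int in auto)
  have right_deriv2: "(deriv (RL_right_int \<alpha> f) has_real_derivative R2 x / ?\<Gamma>) (at x)" if x: "x > 0" for x
    by (rule has_field_derivative_transform_within_open[where S = "{0<..}", OF DERIV_cdivide[OF R_deriv(2)[OF x]]])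
       (use x in \<open>auto simp: DERIV_imp_deriv[OF right_deriv]\<close>)
  have right_eq: "RL_right \<alpha> f x = g x / ?\<Gamma>" if x: "x > 0" for x
    using DERIV_imp_deriv[OF right_deriv2[OF x]] x by (simp add: RL_right_def g_def R2_def numeral_2_eq_2)
  have right_defined: "RL_right_defined \<alpha> f"
    unfolding RL_right_defined_def field_differentiable_def
    using right_integrable right_deriv right_deriv2 by blast

  have kernel_f: "mult_kernel M V f x = (LINT y|lborel. v y * f0 (x * y))"
    and kernel_f_int: "integrable M (\<lambda>w. f (x * V w))" if x: "x > 0" for x
  proof -
    have eq: "f (x * V w) = f0 (x * V w)" if "w \<in> space M" for w
      using V[OF that] x by (intro f) simp
    have m: "(\<lambda>y. f0 (x * y)) \<in> borel_measurable borel" by measurable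
    show "mult_kernel M V f x = (LINT y|lborel. v y * f0 (x * y))"
      unfolding mult_kernel_def lbe[OF m, symmetric] by (intro Bochner_Integration.integral_cong eq) auto
    have "integrable M (\<lambda>w. f0 (x * V w))"
      unfolding lbi[OF m] by (rule bounded_int) (auto intro: abs_le_C x)
    thus "integrable M (\<lambda>w. f (x * V w))"
      by (subst Bochner_Integration.integrable_cong[OF refl eq]) auto
  qed
  have kernel_R: "mult_kernel M V (RL_right \<alpha> f) x = H x / ?\<Gamma>"
    and kernel_R_int: "integrable M (\<lambda>w. RL_right \<alpha> f (x * V w))" if x: "x > 0" for x
  proof -
    have eq: "RL_right \<alpha> f (x * V w) = g (x * V w) / ?\<Gamma>" if "w \<in> space M" for w
      using V[OF that] x by (intro right_eq) simp
    have m: "(\<lambda>y. g (x * y) / ?\<Gamma>) \<in> borel_measurable borel" by measurable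
    have "mult_kernel M V (RL_right \<alpha> f) x = (LINT y|lborel. v y * (g (x * y) / ?\<Gamma>))"
      unfolding mult_kernel_def lbe[OF m, symmetric] by (intro Bochner_Integration.integral_cong eq) auto
    thus "mult_kernel M V (RL_right \<alpha> f) x = H x / ?\<Gamma>" by (simp add: H_def)
    have "integrable lborel (\<lambda>y. v y * g (x * y))"
      by (rule bounded_int) (auto intro: abs_g_le x)
    hence "integrable lborel (\<lambda>y. v y * g (x * y) / ?\<Gamma>)" by (rule integrable_divide)
    hence "integrable M (\<lambda>w. g (x * V w) / ?\<Gamma>)"
      unfolding lbi[OF m] by simp
    thus "integrable M (\<lambda>w. RL_right \<alpha> f (x * V w))"
      by (subst Bochner_Integration.integrable_cong[OF refl eq]) auto
  qed

  have kernel_deriv: "(mult_kernel M V f has_real_derivative G x) (at x)" if x: "x > 0" for x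
    by (rule has_field_derivative_transform_within_open[where S = "{0<..}", OF G_deriv[OF x]])
       (use x kernel_f in auto)
  have D1_eq: "D1 (mult_kernel M V f) x = G x" if x: "x > 0" for x
  proof -
    have "at x within {0..} = at x" using x by (intro at_within_interior) auto
    thus ?thesis
      using kernel_deriv[OF x] unfolding D1_def has_real_derivative_iff_has_vector_derivative
      by (simp add: vector_derivative_at)
  qed
  have left: "set_integrable lborel {0..x} (\<lambda>t. D1 (mult_kernel M V f) t * (x - t) powr (1 - \<alpha>) / ?\<Gamma>)"
    "RL_left_int \<alpha> (D1 (mult_kernel M V f)) x = (LINT r|lborel. indicator {0<..<x} r * H r) / ?\<Gamma>" if x: "x > 0" for x
  proof -
    let ?l = "\<lambda>t. indicator {0..x} t *\<^sub>R (D1 (mult_kernel M V f) t * (x - t) powr (1 - \<alpha>) / ?\<Gamma>)"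
    let ?r = "\<lambda>t. indicator {0<..<x} t * (G t * (x - t) powr (1 - \<alpha>)) / ?\<Gamma>"
    \<comment> \<open>The end points form a null set; so the one-sided derivative at \<open>0\<close> need not be computed.\<close>
    have eq: "?l t = ?r t" if "t \<notin> {0, x}" for t
      using that D1_eq[of t] by (auto simp: indicator_def)
    have "integrable lborel ?r"
    proof (rule integrable_divide, rule Bochner_Integration.integrable_bound)
      show "integrable lborel (\<lambda>t. ((LINT y|lborel. v y * y) * C) * (indicator {0<..<x} t * (x - t) powr (1 - \<alpha>)))"
        by (intro integrable_mult_right integrable_dist_powr x)
      show "AE t in lborel. norm (indicator {0<..<x} t * (G t * (x - t) powr (1 - \<alpha>)))
         \<le> norm (((LINT y|lborel. v y * y) * C) * (indicator {0<..<x} t * (x - t) powr (1 - \<alpha>)))"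
      proof (rule AE_I2)
        fix t
        show "norm (indicator {0<..<x} t * (G t * (x - t) powr (1 - \<alpha>)))
         \<le> norm (((LINT y|lborel. v y * y) * C) * (indicator {0<..<x} t * (x - t) powr (1 - \<alpha>)))"
          using order_trans[OF abs_G_le[of t] abs_ge_self]
          by (cases "t \<in> {0<..<x}") (auto simp: abs_mult intro!: mult_right_mono)
      qed
    qed measurable
    moreover have "integrable lborel ?l \<longleftrightarrow> integrable lborel ?r"
      by (rule integrable_discrete_difference[where X = "{0, x}"], simp, simp, simp, rule eq)
    ultimately show "set_integrable lborel {0..x} (\<lambda>t. D1 (mult_kernel M V f) t * (x - t) powr (1 - \<alpha>) / ?\<Gamma>)"
      unfolding set_integrable_def by blast
    have "RL_left_int \<alpha> (D1 (mult_kernel M V f)) x = (LINT t|lborel. ?r t)"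
      unfolding RL_left_int_def set_lebesgue_integral_def
      by (rule integral_discrete_difference[where X = "{0, x}"], simp, simp, simp, rule eq)
    thus "RL_left_int \<alpha> (D1 (mult_kernel M V f)) x = (LINT r|lborel. indicator {0<..<x} r * H r) / ?\<Gamma>"
      using fractional_integral_identity[OF x] by simp
  qed
  have left_deriv: "(RL_left_int \<alpha> (D1 (mult_kernel M V f)) has_real_derivative H x / ?\<Gamma>) (at x)" if x: "x > 0" for x
    by (rule has_field_derivative_transform_within_open[where S = "{0<..}", OF DERIV_cdivide[OF H_antiderivative[OF x]]])
       (use x left(2) in auto)
  have "Delta_plus_defined \<alpha> (mult_kernel M V f)"
    unfolding Delta_plus_defined_def RL_left_defined_def field_differentiable_def
    using kernel_deriv left(1) left_deriv by blast
  moreover have "Delta_plus \<alpha> (mult_kernel M V f) x = mult_kernel M V (RL_right \<alpha> f) x" if "x > 0" for x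
    using DERIV_imp_deriv[OF left_deriv[OF that]] kernel_R[OF that] by (simp add: Delta_plus_def RL_left_def)
  moreover have "mult_kernel_defined M V f" "mult_kernel_defined M V (RL_right \<alpha> f)"
    unfolding mult_kernel_defined_def using kernel_f_int kernel_R_int by blast+
  ultimately show ?thesis using right_defined by blast
qed

end

section \<open>Test functions\<close>

text \<open>The classical trick of Landau: by the mean value theorem the derivative somewhere in
\<open>[x, x + 1]\<close> is a difference of two function values, and it varies there by no more
than the bound on the second derivative.\<close>

lemma landau_derivative_bound:
  fixes f0 f1 f2 :: "real \<Rightarrow> real"
  assumes cont: "continuous_on {0..} f0" "continuous_on {0..} f1"
    and deriv: "\<And>x. x > 0 \<Longrightarrow> (f0 has_real_derivative f1 x) (at x)" "\<And>x. x > 0 \<Longrightarrow> (f1 has_real_derivative f2 x) (at x)"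
    and bound: "\<And>y. x \<le> y \<Longrightarrow> \<bar>f0 y\<bar> \<le> K" "\<And>y. x \<le> y \<Longrightarrow> \<bar>f2 y\<bar> \<le> K" and x: "0 \<le> x"
  shows "\<bar>f1 x\<bar> \<le> 3 * K"
proof -
  have diff: "f0 differentiable (at y)" "f1 differentiable (at y)" if "y > 0" for y
    unfolding real_differentiable_def using deriv[OF that] by blast+
  have "\<exists>l z. x < z \<and> z < x + 1 \<and> (f0 has_real_derivative l) (at z) \<and> f0 (x + 1) - f0 x = (x + 1 - x) * l"
    using x by (intro MVT continuous_on_subset[OF cont(1)] diff) auto
  then obtain l z where z: "x < z" "z < x + 1" "(f0 has_real_derivative l) (at z)" "f0 (x + 1) - f0 x = l" by auto
  have l: "l = f1 z" using DERIV_unique[OF z(3) deriv(1)[of z]] z(1) x by simp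
  have "\<exists>l u. x < u \<and> u < z \<and> (f1 has_real_derivative l) (at u) \<and> f1 z - f1 x = (z - x) * l"
    using x z(1) by (intro MVT continuous_on_subset[OF cont(2)] diff) auto
  then obtain m u where u: "x < u" "u < z" "(f1 has_real_derivative m) (at u)" "f1 z - f1 x = (z - x) * m" by auto
  have m: "m = f2 u" using DERIV_unique[OF u(3) deriv(2)[of u]] u(1) x by simp
  have "\<bar>(z - x) * m\<bar> \<le> 1 * \<bar>m\<bar>" unfolding abs_mult using z by (intro mult_right_mono) auto
  hence "\<bar>(z - x) * m\<bar> \<le> K" using bound(2)[of u] u m by simp
  moreover have "\<bar>f0 (x + 1)\<bar> \<le> K" "\<bar>f0 x\<bar> \<le> K" using bound(1) by auto
  ultimately show ?thesis using u(4) z(4) l by linarith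
qed

text \<open>Unlike \<open>x^(- \<gamma>)\<close>, the weight \<open>(1 + x)^(- \<gamma>)\<close> is bounded near
\<open>0\<close>; on an initial segment the estimate comes from compactness, beyond it from the
limit.\<close>

lemma polynomial_decay_bound:
  fixes p :: "real \<Rightarrow> real"
  assumes lim: "((\<lambda>x. x powr \<gamma> * p x) \<longlongrightarrow> 0) at_top" and cont: "continuous_on {0..} p" and \<gamma>: "\<gamma> > 0"
  shows "\<exists>C. \<forall>x\<ge>0. \<bar>p x\<bar> \<le> C * (1 + x) powr (- \<gamma>)"
proof -
  have "\<forall>\<^sub>F x in at_top. \<bar>x powr \<gamma> * p x\<bar> < 1"
    using order_tendstoD(2)[OF tendsto_rabs[OF lim], of 1] by simp
  then obtain X0 where X0: "\<And>x. x \<ge> X0 \<Longrightarrow> \<bar>x powr \<gamma> * p x\<bar> < 1"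
    by (auto simp: eventually_at_top_linorder)
  define X where "X = max X0 1"
  have "bounded (p ` {0..X})"
    by (intro compact_imp_bounded compact_continuous_image continuous_on_subset[OF cont]) auto
  then obtain K where "\<forall>y\<in>p ` {0..X}. norm y \<le> K"
    unfolding bounded_iff by blast
  hence K: "\<And>x. x \<in> {0..X} \<Longrightarrow> \<bar>p x\<bar> \<le> K" by auto
  have "0 \<in> {0..X}" by (simp add: X_def)
  from order_trans[OF abs_ge_zero K[OF this]] have K0: "K \<ge> 0" .
  show ?thesis
  proof (intro exI[of _ "K * (1 + X) powr \<gamma> + 2 powr \<gamma>"] allI impI)
    fix x :: real assume x: "x \<ge> 0"
    show "\<bar>p x\<bar> \<le> (K * (1 + X) powr \<gamma> + 2 powr \<gamma>) * (1 + x) powr (- \<gamma>)"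
    proof (cases "x \<le> X")
      case True
      have "\<bar>p x\<bar> \<le> K" using K x True by auto
      also have "K = K * ((1 + x) powr \<gamma> * (1 + x) powr (- \<gamma>))"
        using x by (simp add: powr_add[symmetric])
      also have "\<dots> \<le> K * ((1 + X) powr \<gamma> * (1 + x) powr (- \<gamma>))"
        using x True K0 \<gamma> by (intro mult_left_mono mult_right_mono powr_mono2) auto
      also have "\<dots> \<le> (K * (1 + X) powr \<gamma> + 2 powr \<gamma>) * (1 + x) powr (- \<gamma>)"
        by (simp add: distrib_right)
      finally show ?thesis .
    next
      case False
      hence x1: "x \<ge> X0" "x \<ge> 1" by (auto simp: X_def)
      have "x powr \<gamma> * \<bar>p x\<bar> \<le> 1" using X0[OF x1(1)] by (simp add: abs_mult)
      hence "\<bar>p x\<bar> \<le> x powr (- \<gamma>)"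
        using x1 by (simp add: powr_minus field_simps)
      also have "x powr (- \<gamma>) = 2 powr \<gamma> * (2 * x) powr (- \<gamma>)"
        using x1 by (simp add: powr_mult powr_minus)
      also have "(2 * x) powr (- \<gamma>) \<le> (1 + x) powr (- \<gamma>)"
        using x1 \<gamma> by (intro powr_mono2') auto
      also have "2 powr \<gamma> * (1 + x) powr (- \<gamma>) \<le> (K * (1 + X) powr \<gamma> + 2 powr \<gamma>) * (1 + x) powr (- \<gamma>)"
        using K0 by (intro mult_right_mono) auto
      finally show ?thesis by simp
    qed
  qed
qed

lemma D1_has_derivative:
  assumes "f differentiable_on {0..}" "x > 0"
  shows "((\<lambda>x. f \<bar>x\<bar>) has_real_derivative D1 f \<bar>x\<bar>) (at x)"
proof -
  have "at x within {0..} = at x" using assms(2) by (intro at_within_interior) auto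
  moreover have "(f has_vector_derivative D1 f x) (at x within {0..})"
    using assms unfolding D1_def vector_derivative_works[symmetric] by (auto simp: differentiable_on_def)
  ultimately have "(f has_real_derivative D1 f \<bar>x\<bar>) (at x)"
    using assms(2) by (simp add: has_real_derivative_iff_has_vector_derivative)
  thus ?thesis
    by (rule has_field_derivative_transform_within_open[where S = "{0<..}"]) (use assms(2) in auto)
qed

theorem mainTheorem1:
  fixes \<alpha> :: real and M :: "'a measure" and V :: "'a \<Rightarrow> real" and f :: "real \<Rightarrow> real"
  assumes "1 < \<alpha>" and "\<alpha> < 2"
    and "prob_space M"
    and "\<forall>\<omega>\<in>space M. 0 < V \<omega>"
    and "distributed M lborel V (\<lambda>t. ennreal (v_density \<alpha> t))"
    and "f \<in> test_space \<alpha>"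
  shows "mult_kernel_defined M V f \<and> Delta_plus_defined \<alpha> (mult_kernel M V f) \<and>
         RL_right_defined \<alpha> f \<and> mult_kernel_defined M V (RL_right \<alpha> f) \<and>
         (\<forall>x>0. Delta_plus \<alpha> (mult_kernel M V f) x = mult_kernel M V (RL_right \<alpha> f) x)"
proof -
  from \<open>f \<in> test_space \<alpha>\<close> obtain \<gamma> where \<gamma>: "\<gamma> > 2 - \<alpha>"
      and lim: "((\<lambda>x. x powr \<gamma> * (\<bar>f x\<bar> + \<bar>D1 (D1 f) x\<bar>)) \<longlongrightarrow> 0) at_top"
      and f0: "D1 f 0 = 0" and d: "f differentiable_on {0..}" "D1 f differentiable_on {0..}"
      and c2: "continuous_on {0..} (D1 (D1 f))"
    by (auto simp: test_space_def C2b_def)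
  \<comment> \<open>Even extensions: continuous on the line, and unchanged where they matter.\<close>
  define f0 f1 f2 where "f0 = (\<lambda>x. f \<bar>x\<bar>)" and "f1 = (\<lambda>x. D1 f \<bar>x\<bar>)" and "f2 = (\<lambda>x. D1 (D1 f) \<bar>x\<bar>)"
  note defs = f0_def f1_def f2_def
  have c: "continuous_on {0..} f" "continuous_on {0..} (D1 f)"
    using d by (auto intro: differentiable_imp_continuous_on)
  have cont: "continuous_on UNIV f0" "continuous_on UNIV f1" "continuous_on UNIV f2"
    unfolding defs
    by (rule continuous_on_compose2[OF c(1)] continuous_on_compose2[OF c(2)] continuous_on_compose2[OF c2];
        auto intro: continuous_intros)+
  have deriv: "(f0 has_real_derivative f1 x) (at x)" "(f1 has_real_derivative f2 x) (at x)" if "x > 0" for x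
    unfolding defs by (intro D1_has_derivative d that)+
  have \<gamma>0: "\<gamma> > 0" using \<gamma> \<open>\<alpha> < 2\<close> by linarith
  have "\<exists>C. \<forall>x\<ge>0. \<bar>\<bar>f x\<bar> + \<bar>D1 (D1 f) x\<bar>\<bar> \<le> C * (1 + x) powr (- \<gamma>)"
    by (intro polynomial_decay_bound lim \<gamma>0 continuous_intros c c2)
  then obtain C where C: "\<And>x. x \<ge> 0 \<Longrightarrow> \<bar>f0 x\<bar> + \<bar>f2 x\<bar> \<le> C * (1 + x) powr (- \<gamma>)"
    by (auto simp: defs)
  have "0 \<le> C" using C[of 0] by simp
  have mono: "C * (1 + y) powr (- \<gamma>) \<le> C * (1 + x) powr (- \<gamma>)" if "0 \<le> x" "x \<le> y" for x y
    using that \<gamma>0 \<open>0 \<le> C\<close> by (intro mult_left_mono powr_mono2') auto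
  have b: "\<bar>f0 y\<bar> \<le> C * (1 + x) powr (- \<gamma>)" "\<bar>f2 y\<bar> \<le> C * (1 + x) powr (- \<gamma>)" if "0 \<le> x" "x \<le> y" for x y
    using C[of y] mono[OF that] that by auto
  have le3: "C * (1 + x) powr (- \<gamma>) \<le> (3 * C) * (1 + x) powr (- \<gamma>)" for x
    using \<open>0 \<le> C\<close> by (intro mult_right_mono) auto
  interpret decaying_test \<alpha> f0 f1 f2 \<gamma> "3 * C"
  proof
    show "\<bar>f0 x\<bar> \<le> (3 * C) * (1 + x) powr (- \<gamma>)" "\<bar>f2 x\<bar> \<le> (3 * C) * (1 + x) powr (- \<gamma>)" if "x \<ge> 0" for x
      using b[of x x] le3[of x] that by auto
    show "\<bar>f1 x\<bar> \<le> (3 * C) * (1 + x) powr (- \<gamma>)" if "x \<ge> 0" for x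
    proof -
      have "\<bar>f1 x\<bar> \<le> 3 * (C * (1 + x) powr (- \<gamma>))"
        by (rule landau_derivative_bound[of f0 f1 f2])
           (use deriv b that in \<open>auto intro: continuous_on_subset[OF cont(1)] continuous_on_subset[OF cont(2)]\<close>)
      thus ?thesis by simp
    qed
    show "f1 0 = 0" by (simp add: f1_def f0)
  qed (use assms \<gamma> cont deriv in auto)
  show ?thesis
    by (rule commutation) (use assms in \<open>auto simp: f0_def\<close>)
qed

end
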